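(* Let $K$ be a real, continuous, isotropic and positive definite kernel on $S^1\times S^1$. The following assertions are equivalent: (i) $K$ is strictly positive definite; (ii) $\{(k,l)\in\mathbb{Z}^2:(|k|,|l|)\in J_K\}$ intersects all the translations of each lattice in $\mathbb{Z}^2$; (iii) $\{(k,l)\in\mathbb{Z}^2:(|k|,|l|)\in J_K\}$ intersects all the translations of each rectangular lattice in $\mathbb{Z}^2$.
   Context: $S^1$ is the unit circle in $\mathbb{R}^2$ with its geodesic distance, and $\cdot$ is the usual inner product of $\mathbb{R}^2$. A real kernel $K$ on $S^1\times S^1$ is a function $K:(S^1\times S^1)\times(S^1\times S^1)\to\mathbb{R}$. It is isotropic if there is a function $K_r:[-1,1]^2\to\mathbb{R}$ (the isotropic part of $K$) with $K((x,z),(y,w))=K_r(x\cdot y,z\cdot w)$ for all $x,y,z,w\in S^1$. A real kernel $K$ on an infinite set $X$ is positive definite if $\sum_{\mu,\nu=1}^n c_\mu c_\nu K(x_\mu,x_\nu)\ge 0$ for every positive integer $n$, all distinct points $x_1,\dots,x_n\in X$ and all real scalars $c_1,\dots,c_n$. It is strictly positive definite if it is positive definite and these inequalities are strict whenever at least one $c_\mu$ is nonzero. Here $X=S^1\times S^1$. $P_k$ is the Tchebyshev polynomial of the first kind of degree $k$, i.e. $P_k(\cos\theta)=\cos k\theta$ (up to a positive normalizing constant, which is irrelevant). It is a known theorem that a real, continuous, isotropic kernel $K$ on $S^1\times S^1$ is positive definite if and only if $K_r(t,s)=\sum_{k,l=0}^\infty a_{k,l}P_k(t)P_l(s)$ for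 $t,s\in[-1,1]$, with all $a_{k,l}\ge 0$ and $\sum_{k,l=0}^\infty a_{k,l}P_k(1)P_l(1)<\infty$. For such $K$, $J_K:=\{(k,l)\in\mathbb{Z}_+^2:a_{k,l}>0\}$, where $\mathbb{Z}_+=\{0,1,2,\dots\}$. A lattice of $\mathbb{Z}^2$ is a subgroup of the form $(a,b)\mathbb{Z}+(0,d)\mathbb{Z}:=\{(pa,pb+qd):p,q\in\mathbb{Z}\}$ with $a,b,d\in\mathbb{Z}$ and $a,d>0$ (equivalently, a subgroup of rank 2; $\mathbb{Z}^2$ itself is allowed). A rectangular lattice is one of the form $(a\mathbb{Z},b\mathbb{Z}):=\{(pa,qb):p,q\in\mathbb{Z}\}$ with $a,b>0$ integers. A translation of a subgroup $S$ of $\mathbb{Z}^2$ is a set $(j,j')+S$ with $(j,j')\in\mathbb{Z}^2$. *)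

theory Defs
  imports "HOL-Analysis.Analysis"
begin

section \<open>Positive definite kernels\<close>

definition positive_definite_on :: "'a set \<Rightarrow> ('a \<Rightarrow> 'a \<Rightarrow> real) \<Rightarrow> bool" where
  "positive_definite_on X K \<longleftrightarrow>
     (\<forall>n \<ge> 1. \<forall>(x :: nat \<Rightarrow> 'a) (c :: nat \<Rightarrow> real).
        inj_on x {..<n} \<and> x ` {..<n} \<subseteq> X \<longrightarrow>
        (\<Sum>\<mu><n. \<Sum>\<nu><n. c \<mu> * c \<nu> * K (x \<mu>) (x \<nu>)) \<ge> 0)"

definition strictly_positive_definite_on :: "'a set \<Rightarrow> ('a \<Rightarrow> 'a \<Rightarrow> real) \<Rightarrow> bool" where
  "strictly_positive_definite_on X K \<longleftrightarrow>
     positive_definite_on X K \<and>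
     (\<forall>n \<ge> 1. \<forall>(x :: nat \<Rightarrow> 'a) (c :: nat \<Rightarrow> real).
        inj_on x {..<n} \<and> x ` {..<n} \<subseteq> X \<and> (\<exists>\<mu><n. c \<mu> \<noteq> 0) \<longrightarrow>
        (\<Sum>\<mu><n. \<Sum>\<nu><n. c \<mu> * c \<nu> * K (x \<mu>) (x \<nu>)) > 0)"


section \<open>Isotropic kernels on the product of two circles\<close>

text \<open>The circle carries the topology induced from the plane, which is also the topology
  of the geodesic distance.\<close>

abbreviation circle :: "(real ^ 2) set" where
  "circle \<equiv> sphere 0 1"

text \<open>Kernels are total functions on pairs of points of the plane; only their values on
  the product of circles matter in what follows.\<close>

type_synonym torus_kernel = "(real ^ 2) \<times> (real ^ 2) \<Rightarrow> (real ^ 2) \<times> (real ^ 2) \<Rightarrow> real"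

definition continuous_kernel :: "torus_kernel \<Rightarrow> bool" where
  "continuous_kernel K \<longleftrightarrow>
     continuous_on ((circle \<times> circle) \<times> (circle \<times> circle)) (\<lambda>(p, q). K p q)"

definition isotropic_part :: "torus_kernel \<Rightarrow> (real \<Rightarrow> real \<Rightarrow> real) \<Rightarrow> bool" where
  "isotropic_part K Kr \<longleftrightarrow>
     (\<forall>x\<in>circle. \<forall>z\<in>circle. \<forall>y\<in>circle. \<forall>w\<in>circle. K (x, z) (y, w) = Kr (x \<bullet> y) (z \<bullet> w))"

definition isotropic :: "torus_kernel \<Rightarrow> bool" where
  "isotropic K \<longleftrightarrow> (\<exists>Kr. isotropic_part K Kr)"


section \<open>Chebyshev expansions\<close>

fun cheb :: "nat \<Rightarrow> real poly" where
  "cheb 0 = 1"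
| "cheb (Suc 0) = [:0, 1:]"
| "cheb (Suc (Suc k)) = [:0, 2:] * cheb (Suc k) - cheb k"

lemma poly_cheb_cos: "poly (cheb k) (cos \<theta>) = cos (real k * \<theta>)"
proof (induction k rule: cheb.induct)
  case (3 k)
  have "cos (real (Suc (Suc k)) * \<theta>) + cos (real k * \<theta>) = 2 * cos \<theta> * cos (real (Suc k) * \<theta>)"
    using cos_add[of "real (Suc k) * \<theta>" \<theta>] cos_diff[of "real (Suc k) * \<theta>" \<theta>]
    by (simp add: algebra_simps)
  then show ?case
    using 3 by simp
qed simp_all

text \<open>The isotropic part is determined by the kernel on the square $[-1,1]^2$, the only place
  where its values are used. Since the terms are nonnegative at $(1,1)$, the double series
  converges absolutely on the whole square, and its coefficients are determined by the kernel.\<close>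

definition cheb_expansion :: "torus_kernel \<Rightarrow> (nat \<Rightarrow> nat \<Rightarrow> real) \<Rightarrow> bool" where
  "cheb_expansion K a \<longleftrightarrow>
     (\<forall>k l. a k l \<ge> 0) \<and>
     (\<lambda>(k, l). a k l * poly (cheb k) 1 * poly (cheb l) 1) summable_on UNIV \<and>
     (\<exists>Kr. isotropic_part K Kr \<and>
        (\<forall>t\<in>{-1..1}. \<forall>s\<in>{-1..1}.
           ((\<lambda>(k, l). a k l * poly (cheb k) t * poly (cheb l) s) has_sum Kr t s) UNIV))"

text \<open>For continuous, isotropic, positive definite kernels an expansion exists and is unique,
  so that the choice below is no choice.\<close>

definition cheb_coeff :: "torus_kernel \<Rightarrow> nat \<Rightarrow> nat \<Rightarrow> real" where
  "cheb_coeff K = (SOME a. cheb_expansion K a)"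

definition J :: "torus_kernel \<Rightarrow> (nat \<times> nat) set" where
  "J K = {(k, l). cheb_coeff K k l > 0}"

definition symmetrized_J :: "torus_kernel \<Rightarrow> (int \<times> int) set" where
  "symmetrized_J K = {(k, l). (nat \<bar>k\<bar>, nat \<bar>l\<bar>) \<in> J K}"


section \<open>Lattices in the plane\<close>

definition lattice :: "(int \<times> int) set \<Rightarrow> bool" where
  "lattice L \<longleftrightarrow> (\<exists>a b d. a > 0 \<and> d > 0 \<and> L = {(p * a, p * b + q * d) | p q. True})"

definition rectangular_lattice :: "(int \<times> int) set \<Rightarrow> bool" where
  "rectangular_lattice L \<longleftrightarrow> (\<exists>a b. a > 0 \<and> b > 0 \<and> L = {(p * a, q * b) | p q. True})"

definition intersects_all_translations :: "(int \<times> int) set \<Rightarrow> (int \<times> int) set \<Rightarrow> bool" where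
  "intersects_all_translations A S \<longleftrightarrow> (\<forall>v :: int \<times> int. A \<inter> (\<lambda>u. v + u) ` S \<noteq> {})"

end

(*
  Existence of the Chebyshev expansion: the limit of the means over the N x N grids of angles is a
  positive functional on continuous functions on the square (Stone-Weierstrass and orthogonality of
  characters). Positive definiteness makes the cosine coefficients computed on each grid nonnegative,
  and finite Fourier inversion bounds their sum, so the series converges uniformly; its difference
  from the kernel is orthogonal to all polynomials.

  With the expansion, the quadratic form of weights c at points with angles (alpha, beta) vanishes iff
  the exponential sum S(k, l) = sum c exp(i (k alpha + l beta)) vanishes on the symmetrized support.
  If the support misses a translate v + N Z^2, the weights cos(2 pi (i v1 + j v2) / N) on the N x N grid
  have S supported on the cosets of v and -v. Conversely, if the points are distinct and c is not zero,
  some value S(k0, l0) is nonzero. The ring generated by the weights, the points, their inverses and 1 / S(k0, l0)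
  has a proper ideal of finite index; modulo it S is periodic and S(k0, l0) is a unit, so S has no zero
  on a translate of some q Z^2.
*)

theory Submission
  imports Defs
begin

section \<open>Finite quotients of finitely generated rings\<close>

text \<open>The hard implication is (iii) to (i). The zeros of an exponential sum may form a
  complicated set, so the argument does not describe them. It certifies nonvanishing on one coset by
  reducing modulo an ideal, where powers of units are periodic because the quotient is finite. The
  obstacle is that weights and points are arbitrary complex numbers, possibly transcendental, so the
  reduction must be constructed: a tower of fields starts at the rationals, adjoins the numbers one
  at a time, and carries along the property that every finite subset of the field lies in a subring
  with a proper ideal of finite index. Each extension asks the field below for the coefficients and
  inverses that it will use. The coset obtained is one of q Z^2, hence rectangular lattices suffice;
  conversely every lattice contains some N Z^2. Grid means play the role of the integral because
  positive definiteness speaks of finitely many points: on a grid a cosine coefficient is, up to a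
  positive factor, a sum of quadratic forms of the kernel for every N, so its sign is known before
  any limit is taken.\<close>

definition subring_set :: "'a::ring_1 set \<Rightarrow> bool" where
  "subring_set A \<longleftrightarrow> 1 \<in> A \<and> (\<forall>x\<in>A. \<forall>y\<in>A. x - y \<in> A \<and> x * y \<in> A)"

definition subfield_set :: "'a::field set \<Rightarrow> bool" where
  "subfield_set F \<longleftrightarrow> subring_set F \<and> (\<forall>x\<in>F. inverse x \<in> F)"

definition ideal_set :: "'a::ring_1 set \<Rightarrow> 'a set \<Rightarrow> bool" where
  "ideal_set I A \<longleftrightarrow> I \<subseteq> A \<and> 0 \<in> I \<and> (\<forall>x\<in>I. \<forall>y\<in>I. x - y \<in> I) \<and> (\<forall>a\<in>A. \<forall>x\<in>I. a * x \<in> I)"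

text \<open>The quotient appears through a finite set \<open>T\<close> meeting every residue class,
  since \<open>A\<close> is a set rather than a type. \<open>T\<close> may contain elements outside
  \<open>A\<close>; this lets the same \<open>T\<close> serve again for another ring.\<close>

definition has_finite_quotient :: "'a::ring_1 set \<Rightarrow> 'a set \<Rightarrow> bool" where
  "has_finite_quotient A I \<longleftrightarrow> subring_set A \<and> ideal_set I A \<and> 1 \<notin> I \<and>
     (\<exists>T. finite T \<and> (\<forall>a\<in>A. \<exists>t\<in>T. t \<in> A \<and> a - t \<in> I))"

text \<open>Quantifying over all finite subsets makes the property inductive along a tower of
  fields: the subring of the lower field can be asked to contain any finitely many coefficients and
  inverses.\<close>

definition finite_quotients_in :: "'a::ring_1 set \<Rightarrow> bool" where
  "finite_quotients_in F \<longleftrightarrow>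
     (\<forall>Y. finite Y \<and> Y \<subseteq> F \<longrightarrow> (\<exists>A I. Y \<subseteq> A \<and> A \<subseteq> F \<and> has_finite_quotient A I))"

definition polys_over :: "'a::comm_ring_1 set \<Rightarrow> 'a poly set" where
  "polys_over A = {p. \<forall>i. coeff p i \<in> A}"

section \<open>Closure rules for subrings, ideals, and polynomials with coefficients in them\<close>

lemma subring_set_closed:
  assumes "subring_set A"
  shows "1 \<in> A" "0 \<in> A" "x \<in> A \<Longrightarrow> y \<in> A \<Longrightarrow> x - y \<in> A" "x \<in> A \<Longrightarrow> y \<in> A \<Longrightarrow> x * y \<in> A"
    "x \<in> A \<Longrightarrow> - x \<in> A" "x \<in> A \<Longrightarrow> y \<in> A \<Longrightarrow> x + y \<in> A"
proof -
  show 1: "1 \<in> A" and sub: "\<And>x y. x \<in> A \<Longrightarrow> y \<in> A \<Longrightarrow> x - y \<in> A"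
    and "x \<in> A \<Longrightarrow> y \<in> A \<Longrightarrow> x * y \<in> A"
    using assms by (auto simp: subring_set_def)
  show 0: "0 \<in> A" using sub[OF 1 1] by simp
  show minus: "\<And>x. x \<in> A \<Longrightarrow> - x \<in> A" using sub[OF 0] by simp
  show "x \<in> A \<Longrightarrow> y \<in> A \<Longrightarrow> x + y \<in> A" using sub[OF _ minus, of x y] by simp
qed

lemma subring_set_power: "subring_set A \<Longrightarrow> x \<in> A \<Longrightarrow> x ^ n \<in> A"
  by (induction n) (simp_all add: subring_set_closed(1,4))

lemma subring_set_of_nat: "subring_set A \<Longrightarrow> of_nat n \<in> A"
  by (induction n) (simp_all add: subring_set_closed(1,2,6))

lemma ideal_set_closed:
  assumes "ideal_set I A"
  shows "0 \<in> I" "x \<in> I \<Longrightarrow> x \<in> A" "x \<in> I \<Longrightarrow> y \<in> I \<Longrightarrow> x - y \<in> I"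
    "a \<in> A \<Longrightarrow> x \<in> I \<Longrightarrow> a * x \<in> I" "x \<in> I \<Longrightarrow> - x \<in> I" "x \<in> I \<Longrightarrow> y \<in> I \<Longrightarrow> x + y \<in> I"
proof -
  show 0: "0 \<in> I" and sub: "\<And>x y. x \<in> I \<Longrightarrow> y \<in> I \<Longrightarrow> x - y \<in> I"
    and "x \<in> I \<Longrightarrow> x \<in> A" and "a \<in> A \<Longrightarrow> x \<in> I \<Longrightarrow> a * x \<in> I"
    using assms by (auto simp: ideal_set_def)
  show minus: "\<And>x. x \<in> I \<Longrightarrow> - x \<in> I" using sub[OF 0] by simp
  show "x \<in> I \<Longrightarrow> y \<in> I \<Longrightarrow> x + y \<in> I" using sub[OF _ minus, of x y] by simp
qed

lemma ideal_set_sum: "ideal_set I A \<Longrightarrow> (\<And>i. i \<in> S \<Longrightarrow> f i \<in> I) \<Longrightarrow> sum f S \<in> I"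
  by (induction S rule: infinite_finite_induct) (simp_all add: ideal_set_closed(1,6))

text \<open>Lets the \<open>polys_over\<close> rules, which are stated for an ideal, be used for the
  subring as well.\<close>

lemma ideal_set_self: "subring_set A \<Longrightarrow> ideal_set A A"
  unfolding ideal_set_def by (simp add: subring_set_closed)

lemma polys_over_mult:
  assumes "ideal_set I A" "p \<in> polys_over A" "q \<in> polys_over I"
  shows "p * q \<in> polys_over I"
  unfolding polys_over_def mem_Collect_eq coeff_mult
  using assms(2,3)
  by (simp add: polys_over_def ideal_set_sum[OF assms(1)] ideal_set_closed(4)[OF assms(1)])

lemma polys_over_diff: "ideal_set I A \<Longrightarrow> p \<in> polys_over I \<Longrightarrow> q \<in> polys_over I \<Longrightarrow> p - q \<in> polys_over I"
  by (simp add: polys_over_def ideal_set_closed(3))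

lemma polys_over_add: "ideal_set I A \<Longrightarrow> p \<in> polys_over I \<Longrightarrow> q \<in> polys_over I \<Longrightarrow> p + q \<in> polys_over I"
  by (simp add: polys_over_def ideal_set_closed(6))

lemma polys_over_0: "ideal_set I A \<Longrightarrow> 0 \<in> polys_over I"
  by (simp add: polys_over_def ideal_set_closed(1))

lemma polys_over_const: "ideal_set I A \<Longrightarrow> c \<in> I \<Longrightarrow> [:c:] \<in> polys_over I"
  by (simp add: polys_over_def coeff_pCons ideal_set_closed(1) split: nat.split)

lemma polys_over_monom: "ideal_set I A \<Longrightarrow> c \<in> I \<Longrightarrow> monom c n \<in> polys_over I"
  by (simp add: polys_over_def ideal_set_closed(1))

lemma polys_over_smult: "ideal_set I A \<Longrightarrow> c \<in> A \<Longrightarrow> p \<in> polys_over I \<Longrightarrow> smult c p \<in> polys_over I"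
  by (simp add: polys_over_def ideal_set_closed(4))

lemma polys_over_1: "subring_set A \<Longrightarrow> 1 \<in> polys_over A"
  using polys_over_const[OF ideal_set_self] by (metis one_pCons subring_set_closed(1))

lemma polys_over_power:
  assumes A: "subring_set A" and "p \<in> polys_over A"
  shows "p ^ n \<in> polys_over A"
  by (induction n) (simp_all add: polys_over_1 polys_over_mult[OF ideal_set_self] assms)

lemma poly_mem_ideal:
  assumes A: "subring_set A" and I: "ideal_set I A" and p: "p \<in> polys_over I" and x: "x \<in> A"
  shows "poly p x \<in> I"
  unfolding poly_altdef
proof (rule ideal_set_sum[OF I])
  fix i
  have "x ^ i * coeff p i \<in> I"
    using p x by (simp add: polys_over_def ideal_set_closed(4)[OF I] subring_set_power[OF A])
  then show "coeff p i * x ^ i \<in> I" by (simp add: mult.commute)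
qed

text \<open>A monic divisor requires no inverses, so quotient and remainder inherit their
  coefficients from the ideal of \<open>p\<close>, not merely from \<open>A\<close>. A field, a
  subring and a proper ideal all occur later in the role of \<open>I\<close>.\<close>

lemma monic_division:
  assumes I: "ideal_set I A" and f: "f \<in> polys_over A" "lead_coeff f = 1" "degree f > 0"
    and p: "p \<in> polys_over I"
  shows "\<exists>q\<in>polys_over I. \<exists>r\<in>polys_over I. p = f * q + r \<and> degree r < degree f"
proof -
  \<comment> \<open>The induction is on the excess \<open>n\<close> of the degree bound over
    \<open>degree f\<close>; each step cancels the coefficient at
    \<open>n + degree f\<close>.\<close>
  have "\<exists>q\<in>polys_over I. \<exists>r\<in>polys_over I. p = f * q + r \<and> degree r < degree f"
    if "p \<in> polys_over I" "degree p < n + degree f" for n p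
    using that
  proof (induction n arbitrary: p)
    case 0
    then show ?case
      by (intro bexI[of _ 0] bexI[of _ p]) (simp_all add: polys_over_0[OF I])
  next
    case (Suc n)
    define c where "c = coeff p (n + degree f)"
    define p' where "p' = p - f * monom c n"
    have c: "c \<in> I" using Suc by (auto simp: c_def polys_over_def)
    have m: "monom c n \<in> polys_over I" by (rule polys_over_monom[OF I c])
    have p': "p' \<in> polys_over I"
      unfolding p'_def by (intro polys_over_diff[OF I] Suc polys_over_mult[OF I f(1)] m)
    have co: "coeff p' i = coeff p i - c * coeff f (i - n)" if "i \<ge> n + degree f" for i
      using that by (simp add: p'_def mult.commute[of f] coeff_monom_mult)
    have "coeff p' i = 0" if "i \<ge> n + degree f" for i
    proof (cases "i = n + degree f")
      case True
      then show ?thesis using co[OF that] f(2) by (simp add: c_def)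
    next
      case False
      then have "degree p < i" "degree f < i - n" 
        using that Suc.prems(2) by linarith+
      then show ?thesis using co[OF that] by (simp add: coeff_eq_0)
    qed
    \<comment> \<open>\<open>p'\<close> may be 0, whose degree is 0, so the bound itself must be
      positive; this comes from \<open>degree f > 0\<close>.\<close>
    then have "degree p' < n + degree f"
      using f(3) by (intro degree_lessI) simp_all
    from Suc.IH[OF p' this] obtain q r where qr: "q \<in> polys_over I" "r \<in> polys_over I"
      "p' = f * q + r" "degree r < degree f" by blast
    have "p = p' + f * monom c n" by (simp add: p'_def)
    also have "\<dots> = f * (q + monom c n) + r" unfolding qr(3) by (simp add: ring_distribs add_ac)
    finally have "p = f * (q + monom c n) + r" .
    moreover have "q + monom c n \<in> polys_over I" by (rule polys_over_add[OF I qr(1) m])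
    ultimately show ?case using qr(2,4) by blast
  qed
  from this[OF p, of "Suc (degree p)"] show ?thesis by simp
qed

section \<open>Simple field extensions F(x), with \<open>x\<close> algebraic or
  transcendental\<close>

definition adjoin :: "'a::field set \<Rightarrow> 'a \<Rightarrow> 'a set" where
  "adjoin F x = {poly p x / poly q x | p q. p \<in> polys_over F \<and> q \<in> polys_over F \<and> poly q x \<noteq> 0}"

lemma adjoinI: "p \<in> polys_over F \<Longrightarrow> q \<in> polys_over F \<Longrightarrow> poly q x \<noteq> 0 \<Longrightarrow> y = poly p x / poly q x \<Longrightarrow> y \<in> adjoin F x"
  unfolding adjoin_def by blast

lemma adjoinE:
  assumes "y \<in> adjoin F x"
  obtains p q where "p \<in> polys_over F" "q \<in> polys_over F" "poly q x \<noteq> 0" "y = poly p x / poly q x"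
  using assms unfolding adjoin_def by blast

lemma subfield_set_adjoin:
  fixes F :: "'a::field set"
  assumes "subfield_set F"
  shows "subfield_set (adjoin F x)" "F \<subseteq> adjoin F x" "x \<in> adjoin F x"
proof -
  have F: "subring_set F" and I: "ideal_set F F"
    using assms ideal_set_self by (auto simp: subfield_set_def)
  note cl = polys_over_1[OF F] polys_over_mult[OF I] polys_over_diff[OF I] polys_over_0[OF I]
  show "F \<subseteq> adjoin F x"
  proof
    fix c assume "c \<in> F"
    then show "c \<in> adjoin F x" by (intro adjoinI[OF polys_over_const[OF I] cl(1)]) auto
  qed
  then have 1: "1 \<in> adjoin F x" using subring_set_closed(1)[OF F] by blast
  show "x \<in> adjoin F x"
    by (intro adjoinI[of "monom 1 1" _ 1] polys_over_monom[OF I] cl)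
      (auto simp: poly_monom subring_set_closed(1)[OF F])
  have "y - z \<in> adjoin F x \<and> y * z \<in> adjoin F x \<and> inverse y \<in> adjoin F x"
    if "y \<in> adjoin F x" "z \<in> adjoin F x" for y z
  proof -
    from that obtain p q p' q' where pq: "p \<in> polys_over F" "q \<in> polys_over F" "poly q x \<noteq> 0" "y = poly p x / poly q x"
      "p' \<in> polys_over F" "q' \<in> polys_over F" "poly q' x \<noteq> 0" "z = poly p' x / poly q' x"
      by (auto elim!: adjoinE)
    have "y - z \<in> adjoin F x"
      by (rule adjoinI[of "p * q' - p' * q" _ "q * q'"]) (use pq in \<open>auto intro: cl simp: diff_frac_eq\<close>)
    moreover have "y * z \<in> adjoin F x"
      by (rule adjoinI[of "p * p'" _ "q * q'"]) (use pq in \<open>auto intro: cl\<close>)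
    moreover have "inverse y \<in> adjoin F x"
    proof (cases "poly p x = 0")
      case True
      then show ?thesis
        by (intro adjoinI[of 0 _ 1]) (use pq in \<open>auto intro: cl\<close>)
    next
      case False
      then show ?thesis
        by (intro adjoinI[of q _ p]) (use pq in \<open>auto intro: cl\<close>)
    qed
    ultimately show ?thesis by blast
  qed
  with 1 show "subfield_set (adjoin F x)"
    unfolding subfield_set_def subring_set_def by blast
qed

text \<open>A single \<open>g\<close> for the whole set reduces the choice of a specialisation point
  to the avoidance of finitely many roots.\<close>

lemma adjoin_common_denominator:
  fixes F :: "'a::field set"
  assumes "subfield_set F" "finite Y" "Y \<subseteq> adjoin F x"
  shows "\<exists>g\<in>polys_over F. poly g x \<noteq> 0 \<and> (\<forall>y\<in>Y. \<exists>p\<in>polys_over F. y = poly p x / poly g x)"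
  using assms(2,3)
proof (induction Y)
  case empty
  then show ?case
    using polys_over_1[of F] assms(1) by (intro bexI[of _ 1]) (auto simp: subfield_set_def)
next
  case (insert y Y)
  have F: "subring_set F" and I: "ideal_set F F"
    using assms ideal_set_self by (auto simp: subfield_set_def)
  from insert obtain g where g: "g \<in> polys_over F" "poly g x \<noteq> 0" 
    "\<And>y. y \<in> Y \<Longrightarrow> \<exists>p\<in>polys_over F. y = poly p x / poly g x" by blast
  from insert.prems obtain p q where pq: "p \<in> polys_over F" "q \<in> polys_over F" "poly q x \<noteq> 0" "y = poly p x / poly q x"
    by (auto elim!: adjoinE)
  show ?case
  proof (rule bexI[of _ "q * g"], intro conjI ballI)
    show "q * g \<in> polys_over F" using pq g by (intro polys_over_mult[OF I])
    show "poly (q * g) x \<noteq> 0" using pq g by simp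
    fix z assume "z \<in> insert y Y"
    then consider "z = y" | "z \<in> Y" by blast
    then show "\<exists>p\<in>polys_over F. z = poly p x / poly (q * g) x"
    proof cases
      case 1
      then show ?thesis using pq g 
        by (intro bexI[of _ "p * g"] polys_over_mult[OF I]) auto
    next
      case 2
      with g(3) obtain p' where "p' \<in> polys_over F" "z = poly p' x / poly g x" by blast
      then show ?thesis using pq g 
        by (intro bexI[of _ "q * p'"] polys_over_mult[OF I]) auto
    qed
  qed
qed

lemma finite_coeffs: "finite (range (coeff p))"
proof -
  have "range (coeff p) \<subseteq> insert 0 (coeff p ` {..degree p})"
    using coeff_eq_0[of p] by (auto simp: not_le[symmetric])
  then show ?thesis by (rule finite_subset) simp
qed

text \<open>Specialising a transcendental generator at an integer where the common denominator does not vanish.\<close>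

lemma finite_quotients_in_adjoin_transcendental:
  fixes F :: "'a::field_char_0 set"
  assumes F: "subfield_set F" and good: "finite_quotients_in F"
    and tr: "\<And>p. p \<in> polys_over F \<Longrightarrow> poly p x = 0 \<Longrightarrow> p = 0"
  shows "finite_quotients_in (adjoin F x)"
  unfolding finite_quotients_in_def
proof (intro allI impI, elim conjE)
  fix Y assume Y: "finite Y" "Y \<subseteq> adjoin F x"
  have FR: "subring_set F" and FI: "ideal_set F F"
    using F ideal_set_self by (auto simp: subfield_set_def)
  from adjoin_common_denominator[OF F Y] obtain g where g: "g \<in> polys_over F" "poly g x \<noteq> 0"
    "\<And>y. y \<in> Y \<Longrightarrow> \<exists>p\<in>polys_over F. y = poly p x / poly g x" by blast
  from g(3) obtain P where P: "\<And>y. y \<in> Y \<Longrightarrow> P y \<in> polys_over F" "\<And>y. y \<in> Y \<Longrightarrow> y = poly (P y) x / poly g x"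
    by metis
  \<comment> \<open>A nonzero \<open>g\<close> has finitely many roots, while characteristic 0
    supplies infinitely many integers. An integer is chosen because it lies in every
    subring.\<close>
  from g(2) have "g \<noteq> 0" by auto
  then have "finite {y. poly g y = 0}" by (rule poly_roots_finite)
  moreover have "infinite (range (of_nat :: nat \<Rightarrow> 'a))"
    by (rule range_inj_infinite) (auto simp: inj_def)
  ultimately have "\<not> range (of_nat :: nat \<Rightarrow> 'a) \<subseteq> {y. poly g y = 0}"
    using finite_subset by blast
  then obtain m where m: "poly g (of_nat m) \<noteq> 0" by blast
  define w :: 'a where "w = of_nat m"
  \<comment> \<open>The inverse of \<open>poly g w\<close> is put into the ring below so that the
    denominators remain units after \<open>x\<close> is replaced by \<open>w\<close>.\<close>
  define Z where "Z = insert (inverse (poly g w)) (range (coeff g) \<union> (\<Union>y\<in>Y. range (coeff (P y))))"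
  have wF: "w \<in> F" unfolding w_def by (rule subring_set_of_nat[OF FR])
  have "Z \<subseteq> F"
  proof -
    have "poly g w \<in> F" by (rule poly_mem_ideal[OF FR FI g(1) wF])
    then have "inverse (poly g w) \<in> F" using F by (auto simp: subfield_set_def)
    then show ?thesis using g(1) P(1) unfolding Z_def polys_over_def by auto
  qed
  moreover have "finite Z" unfolding Z_def using Y finite_coeffs by auto
  ultimately obtain A I where AI: "Z \<subseteq> A" "A \<subseteq> F" "has_finite_quotient A I"
    using good unfolding finite_quotients_in_def by meson
  then have A: "subring_set A" and I: "ideal_set I A" and "1 \<notin> I" 
    by (auto simp: has_finite_quotient_def)
  from AI obtain T where T: "finite T" "\<And>a. a \<in> A \<Longrightarrow> \<exists>t\<in>T. t \<in> A \<and> a - t \<in> I"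
    by (auto simp: has_finite_quotient_def)
  have AA: "ideal_set A A" by (rule ideal_set_self[OF A])
  have wA: "w \<in> A" unfolding w_def by (rule subring_set_of_nat[OF A])
  have gA: "g \<in> polys_over A" using AI(1) by (auto simp: Z_def polys_over_def)
  have PA: "P y \<in> polys_over A" if "y \<in> Y" for y
  proof -
    have "range (coeff (P y)) \<subseteq> Z" using that unfolding Z_def by blast
    with AI(1) show ?thesis by (auto simp: polys_over_def)
  qed
  have iA: "inverse (poly g w) \<in> A" using AI(1) by (auto simp: Z_def)
  have gw: "poly g w \<noteq> 0" using m by (simp add: w_def)
  have sub: "polys_over A \<subseteq> polys_over F" using AI(2) by (auto simp: polys_over_def)
  note pc = polys_over_mult[OF AA] polys_over_diff[OF AA] polys_over_power[OF A] gA
  \<comment> \<open>\<open>N a p n\<close> records a fraction representing \<open>a\<close>.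
    \<open>A'\<close> is the ring A[x, 1/g(x)], and \<open>I'\<close> is the preimage of
    \<open>I\<close> under the specialisation of \<open>x\<close> to \<open>w\<close>; as
    \<open>poly g w\<close> is a unit of \<open>A\<close>, testing the numerator suffices.\<close>
  define N where "N a p n \<longleftrightarrow> p \<in> polys_over A \<and> a = poly p x / poly g x ^ n" for a p n
  define A' where "A' = {a. \<exists>p n. N a p n}"
  define I' where "I' = {a. \<exists>p n. N a p n \<and> poly p w \<in> I}"
  have Nsub: "N (a - b) (p * g ^ k - q * g ^ n) (n + k)" and Nmult: "N (a * b) (p * q) (n + k)"
    if "N a p n" "N b q k" for a b p q n k
    using that g(2) unfolding N_def by (auto intro!: pc simp: diff_frac_eq power_add)
  have N1: "N 1 1 0" unfolding N_def using polys_over_1[OF A] by auto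
  have A': "subring_set A'"
    unfolding subring_set_def A'_def using N1 Nsub Nmult by blast
  have pw: "poly p w \<in> A" if "p \<in> polys_over A" for p by (rule poly_mem_ideal[OF A AA that wA])
  have I': "ideal_set I' A'"
    unfolding ideal_set_def
  proof (intro conjI ballI)
    show "I' \<subseteq> A'" by (auto simp: I'_def A'_def)
    have "N 0 0 0" unfolding N_def using polys_over_0[OF AA] by auto
    then show "0 \<in> I'" unfolding I'_def using ideal_set_closed(1)[OF I] by force
  next
    fix a b assume "a \<in> I'" "b \<in> I'"
    then obtain p n q k where N: "N a p n" "N b q k" "poly p w \<in> I" "poly q w \<in> I"
      by (auto simp: I'_def)
    have "poly g w ^ k * poly p w - poly g w ^ n * poly q w \<in> I"
      by (intro ideal_set_closed(3,4)[OF I] N subring_set_power[OF A] pw gA)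
    then have "poly (p * g ^ k - q * g ^ n) w \<in> I" by (simp add: mult.commute)
    with Nsub[OF N(1,2)] show "a - b \<in> I'" unfolding I'_def by blast
  next
    fix a b assume "a \<in> A'" "b \<in> I'"
    then obtain p n q k where N: "N a p n" "N b q k" "poly q w \<in> I"
      by (auto simp: I'_def A'_def)
    have "p \<in> polys_over A" using N by (auto simp: N_def)
    then have "poly (p * q) w \<in> I"
      unfolding poly_mult by (intro ideal_set_closed(4)[OF I] N pw)
    with Nmult[OF N(1,2)] show "a * b \<in> I'" unfolding I'_def by blast
  qed
  have "1 \<notin> I'"
  proof
    assume "1 \<in> I'"
    then obtain p n where N: "N 1 p n" "poly p w \<in> I" by (auto simp: I'_def)
    then have p: "p \<in> polys_over A" "1 = poly p x / poly g x ^ n" by (auto simp: N_def)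
    have "poly (p - g ^ n) x = 0" using p(2) g(2) by (simp add: field_simps)
    moreover have "p - g ^ n \<in> polys_over F" using p(1) pc sub by blast
    \<comment> \<open>Transcendence turns an equality of values at \<open>x\<close> into an equality
      of polynomials, which can then be evaluated at \<open>w\<close>.\<close>
    ultimately have "p = g ^ n" using tr by fastforce
    then have "inverse (poly g w) ^ n * poly g w ^ n \<in> I" 
      using N(2) by (intro ideal_set_closed(4)[OF I] subring_set_power[OF A iA]) auto
    then show False using \<open>1 \<notin> I\<close> gw by (simp add: power_mult_distrib[symmetric])
  qed
  have "\<exists>t\<in>T. t \<in> A' \<and> a - t \<in> I'" if "a \<in> A'" for a
  proof -
    from that obtain p n where N: "N a p n" by (auto simp: A'_def)
    then have p: "p \<in> polys_over A" by (auto simp: N_def)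
    \<comment> \<open>The specialisation of \<open>a\<close> lies in \<open>A\<close>, and a
      representative of its class there represents \<open>a\<close> too; hence \<open>T\<close> is
      reused.\<close>
    have "inverse (poly g w) ^ n * poly p w \<in> A"
      by (intro subring_set_closed(4)[OF A] subring_set_power[OF A iA] pw p)
    from T(2)[OF this] obtain t where t: "t \<in> T" "t \<in> A" "inverse (poly g w) ^ n * poly p w - t \<in> I" by blast
    have Nt: "N t [:t:] 0" unfolding N_def using polys_over_const[OF AA t(2)] by simp
    then have "t \<in> A'" unfolding A'_def by blast
    have "poly g w ^ n * (inverse (poly g w) ^ n * poly p w - t) \<in> I"
      by (intro ideal_set_closed(4)[OF I] subring_set_power[OF A] pw gA t)
    also have "poly g w ^ n * (inverse (poly g w) ^ n * poly p w - t) = poly (p * g ^ 0 - [:t:] * g ^ n) w"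
      using gw by (simp add: field_simps)
    finally have "a - t \<in> I'" using Nsub[OF N Nt] unfolding I'_def by blast
    with t \<open>t \<in> A'\<close> show ?thesis by blast
  qed
  with A' I' \<open>1 \<notin> I'\<close> T(1) have "has_finite_quotient A' I'"
    unfolding has_finite_quotient_def by blast
  moreover have "Y \<subseteq> A'"
  proof
    fix y assume "y \<in> Y"
    then have "N y (P y) 1" unfolding N_def using P(2)[of y] PA by simp
    then show "y \<in> A'" unfolding A'_def by blast
  qed
  moreover have "A' \<subseteq> adjoin F x"
  proof
    fix a assume "a \<in> A'"
    then obtain p n where "N a p n" by (auto simp: A'_def)
    then show "a \<in> adjoin F x"
      using sub pc(3)[of g n] g(2) by (intro adjoinI[of p _ "g ^ n"]) (auto simp: N_def gA)
  qed
  ultimately show "\<exists>A I. Y \<subseteq> A \<and> A \<subseteq> adjoin F x \<and> has_finite_quotient A I" by blast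
qed

text \<open>Take least degree and normalise. Minimality is expressed as linear independence of the
  powers of \<open>x\<close> below \<open>degree f\<close>, the form that yields uniqueness of
  reduced representations.\<close>

lemma minimal_polynomial:
  fixes F :: "'a::field set"
  assumes F: "subfield_set F" and "p0 \<in> polys_over F" "p0 \<noteq> 0" "poly p0 x = 0"
  obtains f where "f \<in> polys_over F" "lead_coeff f = 1" "degree f > 0" "poly f x = 0"
    "\<And>p. p \<in> polys_over F \<Longrightarrow> poly p x = 0 \<Longrightarrow> degree p < degree f \<Longrightarrow> p = 0"
proof -
  have FI: "ideal_set F F"
    using F ideal_set_self by (auto simp: subfield_set_def)
  define R where "R p \<longleftrightarrow> p \<in> polys_over F \<and> p \<noteq> 0 \<and> poly p x = 0" for p
  have "R p0" using assms by (simp add: R_def)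
  then obtain h where h: "R h" "\<And>p. R p \<Longrightarrow> degree h \<le> degree p"
    using exists_least_iff[of "\<lambda>n. \<exists>p. R p \<and> degree p = n"] by (metis not_le)
  define f where "f = smult (inverse (lead_coeff h)) h"
  have lc: "lead_coeff h \<noteq> 0" using h(1) by (simp add: R_def)
  have deg: "degree f = degree h" using lc by (simp add: f_def)
  show ?thesis
  proof (rule that)
    have "lead_coeff h \<in> F" using h(1) by (simp add: R_def polys_over_def)
    then have "inverse (lead_coeff h) \<in> F" using F by (simp add: subfield_set_def)
    then show "f \<in> polys_over F"
      unfolding f_def using h(1) by (intro polys_over_smult[OF FI]) (auto simp: R_def)
    show "lead_coeff f = 1" unfolding f_def using lc by simp
    show "degree f > 0"
    proof (rule ccontr)
      assume "\<not> degree f > 0"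
      then have "degree h = 0" by (simp add: deg)
      then obtain c where "h = [:c:]" by (rule degree_eq_zeroE)
      with h(1) show False by (simp add: R_def)
    qed
    show "poly f x = 0" using h(1) by (simp add: f_def R_def)
    fix p assume "p \<in> polys_over F" "poly p x = 0" "degree p < degree f"
    then show "p = 0" using h(2)[of p] deg by (auto simp: R_def)
  qed
qed

text \<open>Euclid's algorithm evaluated at \<open>x\<close>: dividing \<open>f\<close> by the monic
  multiple of \<open>q\<close> gives c q(x) k(x) = - r(x), so an inverse of r(x), available by
  induction on the degree, yields one of q(x).\<close>

lemma inverse_by_minimal_polynomial:
  fixes F :: "'a::field set"
  assumes F: "subfield_set F" and f: "f \<in> polys_over F" "poly f x = 0"
    "\<And>p. p \<in> polys_over F \<Longrightarrow> poly p x = 0 \<Longrightarrow> degree p < degree f \<Longrightarrow> p = 0"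
    and q: "q \<in> polys_over F" "q \<noteq> 0" "degree q < degree f"
  shows "\<exists>p\<in>polys_over F. poly p x * poly q x = 1"
  using q
proof (induction "degree q" arbitrary: q rule: less_induct)
  case less
  have FI: "ideal_set F F"
    using F ideal_set_self by (auto simp: subfield_set_def)
  define c where "c = inverse (lead_coeff q)"
  have lc: "lead_coeff q \<noteq> 0" using less.prems by simp
  have "lead_coeff q \<in> F" using less.prems by (simp add: polys_over_def)
  then have c: "c \<in> F" using F by (simp add: subfield_set_def c_def)
  have c0: "c * lead_coeff q = 1" using lc by (simp add: c_def)
  show ?case
  proof (cases "degree q = 0")
    case True
    then obtain b where "q = [:b:]" by (rule degree_eq_zeroE)
    then show ?thesis using c0 by (intro bexI[of _ "[:c:]"] polys_over_const[OF FI c]) simp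
  next
    case False
    have q': "smult c q \<in> polys_over F" "lead_coeff (smult c q) = 1" "degree (smult c q) = degree q"
      using c0 less.prems polys_over_smult[OF FI c] by auto
    with False have "degree (smult c q) > 0" by simp
    from monic_division[OF FI q'(1,2) this f(1)] q'(3) obtain k r where
      kr: "k \<in> polys_over F" "r \<in> polys_over F" "f = smult c q * k + r" "degree r < degree q" by auto
    have fx: "c * poly q x * poly k x + poly r x = 0"
      using f(2) unfolding kr(3) by (simp add: mult.assoc)
    \<comment> \<open>A zero remainder would factor \<open>f\<close>; since \<open>q\<close> does
      not vanish at \<open>x\<close>, the proper factor \<open>k\<close> would, against
      minimality.\<close>
    have "r \<noteq> 0"
    proof
      assume r: "r = 0"
      have f0: "f \<noteq> 0" using less.prems(3) by auto
      then have "k \<noteq> 0" using kr(3) r by auto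
      moreover have "smult c q \<noteq> 0" using q'(2) by auto
      ultimately have "degree f = degree q + degree k"
        using kr(3) r q'(3) by (metis add.right_neutral degree_mult_eq)
      with False have "degree k < degree f" by simp
      moreover have "poly k x = 0"
        using fx r less.prems f(3) c0 by fastforce
      ultimately show False using f(3)[OF kr(1)] \<open>k \<noteq> 0\<close> by blast
    qed
    from less.hyps[OF kr(4,2) this] kr(4) less.prems(3) obtain s where s: "s \<in> polys_over F" "poly s x * poly r x = 1"
      by auto
    have "poly r x = - (c * poly q x * poly k x)" using fx by (simp add: eq_neg_iff_add_eq_0 add.commute)
    then have "poly (smult (- c) (s * k)) x * poly q x = 1"
      using s(2) by (simp add: mult_ac)
    moreover have "smult (- c) (s * k) \<in> polys_over F"
      by (intro polys_over_smult[OF FI] polys_over_mult[OF FI] s kr ideal_set_closed(5)[OF FI c])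
    ultimately show ?thesis by blast
  qed
qed

text \<open>Modulo \<open>f\<close> the denominator becomes a nonzero polynomial of low degree,
  which can be inverted; reducing the resulting product once more restores the degree bound.\<close>

lemma adjoin_algebraic_representation:
  fixes F :: "'a::field set"
  assumes F: "subfield_set F" and f: "f \<in> polys_over F" "poly f x = 0" "lead_coeff f = 1" "degree f > 0"
    "\<And>p. p \<in> polys_over F \<Longrightarrow> poly p x = 0 \<Longrightarrow> degree p < degree f \<Longrightarrow> p = 0"
    and y: "y \<in> adjoin F x"
  shows "\<exists>p\<in>polys_over F. degree p < degree f \<and> y = poly p x"
proof -
  have FI: "ideal_set F F"
    using F ideal_set_self by (auto simp: subfield_set_def)
  have reduce: "\<exists>r\<in>polys_over F. degree r < degree f \<and> poly r x = poly p x" if "p \<in> polys_over F" for p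
    using monic_division[OF FI f(1,3,4) that] f(2) by (metis add_0 mult_zero_left poly_add poly_mult)
  from y obtain p q where pq: "p \<in> polys_over F" "q \<in> polys_over F" "poly q x \<noteq> 0" "y = poly p x / poly q x"
    by (rule adjoinE)
  from reduce[OF pq(2)] obtain r where r: "r \<in> polys_over F" "degree r < degree f" "poly r x = poly q x" by blast
  have "r \<noteq> 0" using r(3) pq(3) by auto
  from inverse_by_minimal_polynomial[OF F f(1,2,5) r(1) this r(2)]
  obtain s where s: "s \<in> polys_over F" "poly s x * poly q x = 1" using r(3) by auto
  have "poly s x = 1 / poly q x" using s(2) pq(3) by (simp add: nonzero_eq_divide_eq)
  then have "y = poly (p * s) x" using pq by simp
  with reduce[OF polys_over_mult[OF FI pq(1) s(1)]] show ?thesis by metis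
qed

text \<open>Over a finite quotient of a ring that contains the coefficients of the minimal polynomial, the
  polynomials of degree below that of the minimal polynomial again form a finite quotient.\<close>

lemma finite_quotients_in_adjoin_algebraic:
  fixes F :: "'a::field set"
  assumes F: "subfield_set F" and good: "finite_quotients_in F"
    and p0: "p0 \<in> polys_over F" "p0 \<noteq> 0" "poly p0 x = 0"
  shows "finite_quotients_in (adjoin F x)"
  unfolding finite_quotients_in_def
proof (intro allI impI, elim conjE)
  fix Y assume Y: "finite Y" "Y \<subseteq> adjoin F x"
  have FR: "subring_set F" and FI: "ideal_set F F"
    using F ideal_set_self by (auto simp: subfield_set_def)
  from minimal_polynomial[OF F p0] obtain f where f: "f \<in> polys_over F" "lead_coeff f = 1" "degree f > 0" "poly f x = 0"
    "\<And>p. p \<in> polys_over F \<Longrightarrow> poly p x = 0 \<Longrightarrow> degree p < degree f \<Longrightarrow> p = 0" by blast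
  have "\<forall>y\<in>Y. \<exists>p. p \<in> polys_over F \<and> y = poly p x"
    using adjoin_algebraic_representation[OF F f(1,4,2,3,5)] Y(2) by (meson subsetD)
  then obtain P where P: "\<And>y. y \<in> Y \<Longrightarrow> P y \<in> polys_over F" "\<And>y. y \<in> Y \<Longrightarrow> y = poly (P y) x"
    by metis
  \<comment> \<open>The coefficients of \<open>f\<close> must lie in the ring below so that division
    by \<open>f\<close> stays inside \<open>A\<close> and \<open>I\<close>.\<close>
  define Z where "Z = range (coeff f) \<union> (\<Union>y\<in>Y. range (coeff (P y)))"
  have "Z \<subseteq> F" using f(1) P(1) unfolding Z_def polys_over_def by auto
  moreover have "finite Z" unfolding Z_def using Y finite_coeffs by auto
  ultimately obtain A I where AI: "Z \<subseteq> A" "A \<subseteq> F" "has_finite_quotient A I"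
    using good unfolding finite_quotients_in_def by meson
  then have A: "subring_set A" and I: "ideal_set I A" and "1 \<notin> I" 
    by (auto simp: has_finite_quotient_def)
  from AI obtain T where T: "finite T" "\<And>a. a \<in> A \<Longrightarrow> \<exists>t\<in>T. t \<in> A \<and> a - t \<in> I"
    by (auto simp: has_finite_quotient_def)
  have AA: "ideal_set A A" by (rule ideal_set_self[OF A])
  have fA: "f \<in> polys_over A" using AI(1) by (auto simp: Z_def polys_over_def)
  have PA: "P y \<in> polys_over A" if "y \<in> Y" for y
  proof -
    have "range (coeff (P y)) \<subseteq> Z" using that unfolding Z_def by blast
    with AI(1) show ?thesis by (auto simp: polys_over_def)
  qed
  have subF: "polys_over A \<subseteq> polys_over F" using AI(2) by (auto simp: polys_over_def)
  have IA: "polys_over I \<subseteq> polys_over A" using I by (auto simp: polys_over_def ideal_set_def)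
  define A' where "A' = (\<lambda>p. poly p x) ` polys_over A"
  define I' where "I' = (\<lambda>p. poly p x) ` polys_over I"
  have reduce: "\<exists>r\<in>polys_over B. degree r < degree f \<and> poly r x = poly p x"
    if "ideal_set B A" "p \<in> polys_over B" for p B
    using monic_division[OF that(1) fA f(2,3) that(2)] f(4) by (metis add_0 mult_zero_left poly_add poly_mult)
  have A': "subring_set A'"
    unfolding subring_set_def
  proof (intro conjI ballI)
    show "1 \<in> A'" unfolding A'_def by (rule image_eqI[OF _ polys_over_1[OF A]]) simp
    fix a b assume "a \<in> A'" "b \<in> A'"
    then obtain p q where pq: "a = poly p x" "b = poly q x" "p \<in> polys_over A" "q \<in> polys_over A"
      by (auto simp: A'_def)
    show "a - b \<in> A'" unfolding A'_def
      by (rule image_eqI[OF _ polys_over_diff[OF AA pq(3,4)]]) (simp add: pq)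
    show "a * b \<in> A'" unfolding A'_def
      by (rule image_eqI[OF _ polys_over_mult[OF AA pq(3,4)]]) (simp add: pq)
  qed
  have I': "ideal_set I' A'"
    unfolding ideal_set_def
  proof (intro conjI ballI)
    show "I' \<subseteq> A'" unfolding I'_def A'_def using IA by blast
    show "0 \<in> I'" unfolding I'_def by (rule image_eqI[OF _ polys_over_0[OF I]]) simp
  next
    fix a b assume "a \<in> I'" "b \<in> I'"
    then obtain p q where pq: "a = poly p x" "b = poly q x" "p \<in> polys_over I" "q \<in> polys_over I"
      by (auto simp: I'_def)
    show "a - b \<in> I'" unfolding I'_def
      by (rule image_eqI[OF _ polys_over_diff[OF I pq(3,4)]]) (simp add: pq)
  next
    fix a b assume "a \<in> A'" "b \<in> I'"
    then obtain p q where pq: "a = poly p x" "b = poly q x" "p \<in> polys_over A" "q \<in> polys_over I"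
      by (auto simp: I'_def A'_def)
    show "a * b \<in> I'" unfolding I'_def
      by (rule image_eqI[OF _ polys_over_mult[OF I pq(3,4)]]) (simp add: pq)
  qed
  have "1 \<notin> I'"
  proof
    assume "1 \<in> I'"
    then obtain p where "p \<in> polys_over I" "poly p x = 1" by (auto simp: I'_def)
    with reduce[OF I] obtain r where r: "r \<in> polys_over I" "degree r < degree f" "poly r x = 1" by metis
    \<comment> \<open>\<open>r - 1\<close> vanishes at \<open>x\<close> and has low degree, so
      minimality forces \<open>r = 1\<close>; its constant coefficient then puts 1 into
      \<open>I\<close>.\<close>
    have "r - 1 \<in> polys_over F"
      using r(1) IA subF by (intro polys_over_diff[OF FI] polys_over_1[OF FR]) auto
    moreover have "degree (r - 1) < degree f"
      using r(2) f(3) by (intro degree_diff_less) auto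
    ultimately have "r = 1" using f(5)[of "r - 1"] r(3) by simp
    then have "coeff 1 0 \<in> I" using r(1) by (simp only: polys_over_def mem_Collect_eq)
    then show False using \<open>1 \<notin> I\<close> by simp
  qed
  obtain \<tau> where \<tau>: "\<And>a. a \<in> A \<Longrightarrow> \<tau> a \<in> T \<and> \<tau> a \<in> A \<and> a - \<tau> a \<in> I" using T(2) by metis
  \<comment> \<open>Representatives are taken coefficient by coefficient along 1, x, x^2 and so on,
    which leaves finitely many combinations.\<close>
  define T' where "T' = (\<lambda>c. \<Sum>i<degree f. c i * x ^ i) ` ({..<degree f} \<rightarrow>\<^sub>E T)"
  have "finite T'" unfolding T'_def using T(1) by (intro finite_imageI finite_PiE) auto
  moreover have "\<exists>t\<in>T'. t \<in> A' \<and> a - t \<in> I'" if "a \<in> A'" for a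
  proof -
    from that obtain p where "p \<in> polys_over A" "poly p x = a" by (auto simp: A'_def)
    with reduce[OF AA] obtain r where r: "r \<in> polys_over A" "degree r < degree f" "poly r x = a" by metis
    have co: "\<tau> (coeff r i) \<in> T \<and> \<tau> (coeff r i) \<in> A \<and> coeff r i - \<tau> (coeff r i) \<in> I" for i
      using r(1) by (intro \<tau>) (simp add: polys_over_def)
    define c where "c = (\<lambda>i\<in>{..<degree f}. \<tau> (coeff r i))"
    define s where "s = (\<Sum>i<degree f. monom (c i) i)"
    have cs: "coeff s i = (if i < degree f then \<tau> (coeff r i) else 0)" for i
      unfolding s_def c_def by (simp add: coeff_sum)
    have sx: "poly s x = (\<Sum>i<degree f. c i * x ^ i)"
      by (simp add: s_def poly_sum poly_monom)
    have "c \<in> {..<degree f} \<rightarrow>\<^sub>E T" unfolding c_def using co by auto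
    then have "poly s x \<in> T'" unfolding T'_def sx by blast
    moreover have "poly s x \<in> A'"
      unfolding A'_def using co subring_set_closed(2)[OF A] by (intro imageI) (simp add: polys_over_def cs)
    moreover have "coeff (r - s) i \<in> I" for i
      using co[of i] r(2) ideal_set_closed(1)[OF I] by (simp add: cs coeff_eq_0)
    then have "poly (r - s) x \<in> I'" unfolding I'_def polys_over_def by blast
    then have "a - poly s x \<in> I'" using r(3) by simp
    ultimately show ?thesis by blast
  qed
  ultimately have "has_finite_quotient A' I'"
    using A' I' \<open>1 \<notin> I'\<close> unfolding has_finite_quotient_def by blast
  moreover have "Y \<subseteq> A'" using P(2) PA unfolding A'_def by blast
  moreover have "A' \<subseteq> adjoin F x"
  proof
    fix a assume "a \<in> A'"
    then obtain p where "p \<in> polys_over A" "a = poly p x" by (auto simp: A'_def)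
    then show "a \<in> adjoin F x"
      using subF polys_over_1[OF FR] by (intro adjoinI[of p _ 1]) auto
  qed
  ultimately show "\<exists>A I. Y \<subseteq> A \<and> A \<subseteq> adjoin F x \<and> has_finite_quotient A I" by blast
qed

section \<open>The rationals as the bottom of the tower\<close>

lemma common_denominator_Rats:
  fixes Y :: "'a::field_char_0 set"
  assumes "finite Y" "Y \<subseteq> \<rat>"
  shows "\<exists>D>0. \<forall>y\<in>Y. \<exists>m. y * of_int D = of_int m"
  using assms
proof (induction Y)
  case empty
  show ?case by (intro exI[of _ 1]) simp
next
  case (insert y Y)
  then obtain D where D: "D > 0" "\<And>y. y \<in> Y \<Longrightarrow> \<exists>m. y * of_int D = of_int m" by auto
  from insert.prems obtain a b where ab: "b > 0" "y = of_int a / of_int b"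
    by (metis Rats_cases' insert_subset)
  show ?case
  proof (rule exI[of _ "D * b"], intro conjI ballI)
    show "D * b > 0" using D ab by simp
    fix z assume "z \<in> insert y Y"
    then consider "z = y" | "z \<in> Y" by blast
    then show "\<exists>m. z * of_int (D * b) = of_int m"
    proof cases
      case 1
      then show ?thesis using ab by (intro exI[of _ "a * D"]) simp
    next
      case 2
      then obtain m where "z * of_int D = of_int m" using D(2) by blast
      then have "z * of_int (D * b) = of_int (m * b)" by (simp add: mult.assoc[symmetric])
      then show ?thesis ..
    qed
  qed
qed

text \<open>The ring is Z[1/D], where D clears all denominators, and the ideal is generated by D -
  1. Since D is 1 modulo D - 1, it remains a unit there, so no prime outside the denominators has to
  be chosen.\<close>

lemma finite_quotients_in_Rats: "finite_quotients_in (\<rat> :: 'a::field_char_0 set)"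
  unfolding finite_quotients_in_def
proof (intro allI impI, elim conjE)
  fix Y :: "'a set" assume "finite Y" "Y \<subseteq> \<rat>"
  from common_denominator_Rats[OF this] obtain D0 :: int where D0: "D0 > 0" "\<And>y. y \<in> Y \<Longrightarrow> \<exists>m. y * of_int D0 = of_int m"
    by blast
  \<comment> \<open>The factor 3 makes \<open>M\<close> at least 2 even for \<open>D0 = 1\<close>,
    so that the ideal is proper.\<close>
  define D where "D = 3 * D0"
  define M where "M = D - 1"
  have M: "M > 1" using D0(1) by (simp add: M_def D_def)
  have D: "D > 0" using D0(1) by (simp add: D_def)
  have Dk: "D ^ k mod M = 1" for k
  proof -
    have "D mod M = 1 mod M" unfolding M_def by (metis diff_add_cancel mod_add_self1)
    then have "D ^ k mod M = 1 ^ k mod M" by (metis power_mod)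
    then show ?thesis using M by simp
  qed
  define A where "A = {a :: 'a. \<exists>k m. a * of_int (D ^ k) = of_int m}"
  define I where "I = {a :: 'a. \<exists>k m. a * of_int (D ^ k) = of_int (M * m)}"
  have diff: "(a - b) * of_int (D ^ (k + l)) = of_int (m * D ^ l - n * D ^ k)"
    and mult: "(a * b) * of_int (D ^ (k + l)) = of_int (m * n)"
    if "a * of_int (D ^ k) = of_int m" "b * of_int (D ^ l) = of_int n" for a b :: 'a and k l m n
    unfolding of_int_diff of_int_mult that[symmetric] by (simp_all add: algebra_simps power_add)
  have A: "subring_set A"
    unfolding subring_set_def
  proof (intro conjI ballI)
    have "(1::'a) * of_int (D ^ 0) = of_int 1" by simp
    then show "1 \<in> A" unfolding A_def by blast
    fix a b assume "a \<in> A" "b \<in> A"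
    then obtain k m l n where "a * of_int (D ^ k) = of_int m" "b * of_int (D ^ l) = of_int n"
      unfolding A_def by blast
    from diff[OF this] mult[OF this] show "a - b \<in> A" "a * b \<in> A" unfolding A_def by blast+
  qed
  moreover have "ideal_set I A"
    unfolding ideal_set_def
  proof (intro conjI ballI)
    show "I \<subseteq> A" unfolding I_def A_def by blast
    have "(0::'a) * of_int (D ^ 0) = of_int (M * 0)" by simp
    then show "0 \<in> I" unfolding I_def by blast
  next
    fix a b assume "a \<in> I" "b \<in> I"
    then obtain k m l n where "a * of_int (D ^ k) = of_int (M * m)" "b * of_int (D ^ l) = of_int (M * n)"
      unfolding I_def by blast
    from diff[OF this] have "(a - b) * of_int (D ^ (k + l)) = of_int (M * (m * D ^ l - n * D ^ k))"
      by (simp add: algebra_simps)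
    then show "a - b \<in> I" unfolding I_def by blast
  next
    fix a b assume "a \<in> A" "b \<in> I"
    then obtain k m l n where "a * of_int (D ^ k) = of_int m" "b * of_int (D ^ l) = of_int (M * n)"
      unfolding I_def A_def by blast
    from mult[OF this] have "a * b * of_int (D ^ (k + l)) = of_int (M * (m * n))"
      by (simp add: mult_ac)
    then show "a * b \<in> I" unfolding I_def by blast
  qed
  moreover have "1 \<notin> I"
  proof
    assume "1 \<in> I"
    then obtain k m where "(1::'a) * of_int (D ^ k) = of_int (M * m)" unfolding I_def by blast
    then have "D ^ k = M * m" by (simp only: mult_1 of_int_eq_iff)
    with Dk[of k] show False by simp
  qed
  moreover have "\<exists>t\<in>of_int ` {0..<M}. t \<in> A \<and> a - t \<in> I" if "a \<in> A" for a
  proof -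
    from that obtain k m where km: "a * of_int (D ^ k) = of_int m" unfolding A_def by blast
    \<comment> \<open>Division by \<open>D ^ k\<close> does not change the residue, because
      \<open>D\<close> is 1 modulo \<open>M\<close>.\<close>
    define t where "t = m mod M"
    have "(m - t * D ^ k) mod M = (m - t * 1) mod M"
      by (rule mod_diff_cong) (simp_all add: mod_mult_right_eq[symmetric, of t "D ^ k"] Dk)
    also have "\<dots> = 0" unfolding t_def by (simp add: mod_diff_right_eq)
    finally obtain n where n: "m - t * D ^ k = M * n" by (meson dvd_def mod_0_imp_dvd)
    have t0: "(of_int t :: 'a) * of_int (D ^ 0) = of_int t" by simp
    have "(a - of_int t) * of_int (D ^ (k + 0)) = of_int (M * n)"
      unfolding n[symmetric] using diff[OF km t0] by simp
    then have "a - of_int t \<in> I" unfolding I_def by blast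
    moreover have "of_int t \<in> A" using t0 unfolding A_def by blast
    moreover have "t \<in> {0..<M}" using M by (simp add: t_def)
    ultimately show ?thesis by blast
  qed
  moreover have "finite (of_int ` {0..<M} :: 'a set)" by simp
  ultimately have "has_finite_quotient A I"
    unfolding has_finite_quotient_def by (intro conjI exI[of _ "of_int ` {0..<M}"] ballI)
  moreover have "Y \<subseteq> A"
  proof
    fix y assume "y \<in> Y"
    then obtain m where "y * of_int D0 = of_int m" using D0(2) by blast
    then have "y * of_int (D ^ 1) = of_int (3 * m)" by (simp add: D_def)
    then show "y \<in> A" unfolding A_def by blast
  qed
  moreover have "A \<subseteq> \<rat>"
  proof
    fix a assume "a \<in> A"
    then obtain k m where km: "a * of_int (D ^ k) = of_int m" unfolding A_def by blast
    have "(of_int (D ^ k) :: 'a) \<noteq> 0" using D by simp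
    with km have "a = of_int m / of_int (D ^ k)" by (simp add: nonzero_eq_divide_eq)
    then show "a \<in> \<rat>" by (metis Rats_divide Rats_of_int)
  qed
  ultimately show "\<exists>A I. Y \<subseteq> A \<and> A \<subseteq> \<rat> \<and> has_finite_quotient A I"
    by (intro exI[of _ A] exI[of _ I] conjI)
qed

text \<open>Adjoining the elements of \<open>Y\<close> one by one to the rationals reaches a field
  containing \<open>Y\<close>; each adjunction is algebraic or transcendental and preserves
  \<open>finite_quotients_in\<close>.\<close>

lemma finite_set_in_ring_with_finite_quotient:
  fixes Y :: "'a::field_char_0 set"
  assumes "finite Y"
  shows "\<exists>A I. Y \<subseteq> A \<and> has_finite_quotient A I"
proof -
  have "\<exists>F. subfield_set F \<and> finite_quotients_in F \<and> Y \<subseteq> F"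
    using assms
  proof (induction Y)
    case empty
    have "subfield_set (\<rat> :: 'a set)" by (simp add: subfield_set_def subring_set_def)
    with finite_quotients_in_Rats show ?case by blast
  next
    case (insert x Y)
    then obtain F where F: "subfield_set F" "finite_quotients_in F" "Y \<subseteq> F" by blast
    have "finite_quotients_in (adjoin F x)"
    proof (cases "\<exists>p\<in>polys_over F. p \<noteq> 0 \<and> poly p x = 0")
      case True
      then show ?thesis using finite_quotients_in_adjoin_algebraic[OF F(1,2)] by blast
    next
      case False
      then show ?thesis by (intro finite_quotients_in_adjoin_transcendental[OF F(1,2)]) blast
    qed
    moreover have "insert x Y \<subseteq> adjoin F x" using subfield_set_adjoin(2,3)[OF F(1), of x] F(3) by simp
    ultimately show ?case using subfield_set_adjoin(1)[OF F(1)] by (intro exI[of _ "adjoin F x"] conjI)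
  qed
  then obtain F where F: "finite_quotients_in F" "Y \<subseteq> F" by (elim exE conjE)
  from F(1)[unfolded finite_quotients_in_def, rule_format, OF conjI[OF assms F(2)]]
  show ?thesis by (elim exE conjE) (intro exI conjI)
qed

text \<open>By pigeonhole two powers fall into the same residue class; membership of the inverse in
  \<open>A\<close> allows the lower power to be cancelled.\<close>

lemma unit_power_in_ideal:
  fixes A :: "'a::field set"
  assumes AI: "has_finite_quotient A I" and u: "u \<in> A" "inverse u \<in> A" "u \<noteq> 0"
  shows "\<exists>n>0. u ^ n - 1 \<in> I"
proof -
  from AI have A: "subring_set A" and I: "ideal_set I A" by (auto simp: has_finite_quotient_def)
  from AI obtain T \<tau> where T: "finite T" and \<tau>: "\<And>a. a \<in> A \<Longrightarrow> \<tau> a \<in> T \<and> a - \<tau> a \<in> I"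
    unfolding has_finite_quotient_def by metis
  have "range (\<lambda>n. \<tau> (u ^ n)) \<subseteq> T" using \<tau> subring_set_power[OF A u(1)] by blast
  then have "finite (range (\<lambda>n. \<tau> (u ^ n)))" using T finite_subset by blast
  then have "\<not> inj (\<lambda>n. \<tau> (u ^ n))" using finite_imageD infinite_UNIV_nat by blast
  then obtain i j where ij: "i < j" "\<tau> (u ^ i) = \<tau> (u ^ j)"
    unfolding inj_def by (metis linorder_neqE_nat)
  have m: "u ^ n - \<tau> (u ^ n) \<in> I" for n using \<tau> subring_set_power[OF A u(1)] by blast
  have "(u ^ j - \<tau> (u ^ j)) - (u ^ i - \<tau> (u ^ i)) \<in> I"
    by (rule ideal_set_closed(3)[OF I m m])
  then have "u ^ j - u ^ i \<in> I" using ij(2) by simp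
  then have "inverse u ^ i * (u ^ j - u ^ i) \<in> I"
    by (rule ideal_set_closed(4)[OF I subring_set_power[OF A u(2)]])
  also have "inverse u ^ i * (u ^ j - u ^ i) = u ^ (j - i) - 1"
    using ij(1) u(3) by (simp add: right_diff_distrib power_diff power_inverse field_simps)
  finally show ?thesis using ij(1) by (intro exI[of _ "j - i"]) simp
qed

lemma one_plus_ideal_power_int:
  fixes A :: "'a::field set"
  assumes A: "subring_set A" and I: "ideal_set I A" and u: "u \<in> A" "inverse u \<in> A" "u \<noteq> 0" and "u - 1 \<in> I"
  shows "u powi k - 1 \<in> I"
proof -
  have pow: "v ^ n - 1 \<in> I" if "v \<in> A" "v - 1 \<in> I" for v n
  proof (induction n)
    case 0
    show ?case using ideal_set_closed(1)[OF I] by simp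
  next
    case (Suc n)
    have "v * (v ^ n - 1) + (v - 1) \<in> I"
      by (intro ideal_set_closed(4,6)[OF I] that Suc)
    then show ?case by (simp add: algebra_simps)
  qed
  have "- (inverse u * (u - 1)) \<in> I"
    by (intro ideal_set_closed(4,5)[OF I] assms)
  then have "inverse u - 1 \<in> I" using u(3) by (simp add: algebra_simps)
  from pow[OF u(1) assms(6)] pow[OF u(2) this] show ?thesis
    by (simp add: power_int_def)
qed

text \<open>The product of the separate exponents is a common one. Negative \<open>k\<close> are
  included because the coset extends in all directions.\<close>

lemma common_unit_power_in_ideal:
  fixes A :: "'a::field set"
  assumes AI: "has_finite_quotient A I" and "finite U"
    and "\<And>u. u \<in> U \<Longrightarrow> u \<in> A \<and> inverse u \<in> A \<and> u \<noteq> 0"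
  shows "\<exists>n>0. \<forall>u\<in>U. \<forall>k. u powi (int n * k) - 1 \<in> I"
proof -
  from AI have A: "subring_set A" and I: "ideal_set I A" by (auto simp: has_finite_quotient_def)
  obtain e where e: "\<And>u. u \<in> U \<Longrightarrow> e u > (0::nat) \<and> u ^ e u - 1 \<in> I"
    using unit_power_in_ideal[OF AI] assms(3) by metis
  show ?thesis
  proof (intro exI[of _ "prod e U"] conjI ballI allI)
    show "prod e U > 0" using e by (simp add: prod_pos)
    fix u k assume u: "u \<in> U"
    have "prod e U = e u * prod e (U - {u})" using assms(2) u by (rule prod.remove)
    then have eq: "u powi (int (prod e U) * k) = (u ^ e u) powi (int (prod e (U - {u})) * k)"
      by (simp only: of_nat_mult mult.assoc power_int_mult power_int_of_nat)
    have "inverse (u ^ e u) = inverse u ^ e u" by (simp add: power_inverse)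
    then show "u powi (int (prod e U) * k) - 1 \<in> I"
      unfolding eq using assms(3)[OF u] e[OF u]
      by (intro one_plus_ideal_power_int[OF A I]) (simp_all add: subring_set_power[OF A])
  qed
qed

text \<open>The ring generated by the data and by the inverse of the value at the given point has a
  finite quotient; there the sum is periodic and its value at the given point is a unit.\<close>

lemma exponential_sum_nonzero_on_coset:
  fixes c z w :: "'i \<Rightarrow> 'a::field_char_0"
  assumes M: "finite M" and zw: "\<And>\<mu>. \<mu> \<in> M \<Longrightarrow> z \<mu> \<noteq> 0 \<and> w \<mu> \<noteq> 0"
    and S: "\<And>k l. S k l = (\<Sum>\<mu>\<in>M. c \<mu> * z \<mu> powi k * w \<mu> powi l)" and nz: "S k0 l0 \<noteq> 0"
  shows "\<exists>q>0. \<forall>i j. S (k0 + q * i) (l0 + q * j) \<noteq> 0"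
proof -
  define U where "U = z ` M \<union> w ` M"
  define d where "d \<mu> = c \<mu> * z \<mu> powi k0 * w \<mu> powi l0" for \<mu>
  \<comment> \<open>Including the inverse of \<open>S k0 l0\<close> keeps that value out of every
    proper ideal. \<open>d\<close> absorbs the powers at the base point, so that only the increments
    have to be compared with 1.\<close>
  define Y where "Y = U \<union> inverse ` U \<union> d ` M \<union> {inverse (S k0 l0)}"
  have "finite Y" "finite U" unfolding Y_def U_def using M by auto
  from finite_set_in_ring_with_finite_quotient[OF this(1)] obtain A I where AI: "Y \<subseteq> A" "has_finite_quotient A I"
    by blast
  then have A: "subring_set A" and I: "ideal_set I A" and "1 \<notin> I" by (auto simp: has_finite_quotient_def)
  have units: "u \<in> A \<and> inverse u \<in> A \<and> u \<noteq> 0" if "u \<in> U" for u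
  proof (intro conjI)
    show "u \<in> A" "inverse u \<in> A" using that AI(1) unfolding Y_def by auto
    show "u \<noteq> 0" using that zw unfolding U_def by auto
  qed
  have "\<exists>n>0. \<forall>u\<in>U. \<forall>k. u powi (int n * k) - 1 \<in> I"
    by (rule common_unit_power_in_ideal[OF AI(2) \<open>finite U\<close>]) (rule units)
  then obtain n where "n > 0" and "\<forall>u\<in>U. \<forall>k. u powi (int n * k) - 1 \<in> I"
    by (elim exE conjE)
  then have n: "n > 0" "\<And>u k. u \<in> U \<Longrightarrow> u powi (int n * k) - 1 \<in> I" by auto
  show ?thesis
  proof (intro exI[of _ "int n"] conjI allI notI)
    show "int n > 0" using n by simp
    fix i j assume 0: "S (k0 + int n * i) (l0 + int n * j) = 0"
    have eq: "S (k0 + int n * i) (l0 + int n * j) - S k0 l0 =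
        (\<Sum>\<mu>\<in>M. d \<mu> * (z \<mu> powi (int n * i) * w \<mu> powi (int n * j) - 1))"
      unfolding S sum_subtractf[symmetric]
      by (intro sum.cong) (use zw in \<open>auto simp: d_def power_int_add algebra_simps\<close>)
    have "d \<mu> * (z \<mu> powi (int n * i) * w \<mu> powi (int n * j) - 1) \<in> I" if "\<mu> \<in> M" for \<mu>
    proof -
      have "z \<mu> \<in> U" "w \<mu> \<in> U" "d \<mu> \<in> A" using that AI(1) unfolding U_def Y_def by auto
      note zi = n(2)[OF this(1), of i] and wj = n(2)[OF this(2), of j]
      have "1 \<in> A" by (rule subring_set_closed(1)[OF A])
      have "z \<mu> powi (int n * i) = (z \<mu> powi (int n * i) - 1) + 1" by simp
      then have "z \<mu> powi (int n * i) \<in> A"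
        using subring_set_closed(6)[OF A ideal_set_closed(2)[OF I zi] \<open>1 \<in> A\<close>] by simp
      \<comment> \<open>This is a b - 1 = a (b - 1) + (a - 1), with both differences in
        \<open>I\<close>.\<close>
      from ideal_set_closed(6)[OF I ideal_set_closed(4)[OF I this wj] zi]
      have "z \<mu> powi (int n * i) * w \<mu> powi (int n * j) - 1 \<in> I" by (simp add: algebra_simps)
      then show ?thesis by (rule ideal_set_closed(4)[OF I \<open>d \<mu> \<in> A\<close>])
    qed
    then have "- S k0 l0 \<in> I" using ideal_set_sum[OF I] eq 0 by (metis (no_types, lifting) diff_0)
    then have "S k0 l0 \<in> I" using ideal_set_closed(5)[OF I, of "- S k0 l0"] by simp
    moreover have "inverse (S k0 l0) \<in> A" using AI(1) by (simp add: Y_def)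
    ultimately have "inverse (S k0 l0) * S k0 l0 \<in> I" by (rule ideal_set_closed(4)[OF I, rotated])
    then show False using nz \<open>1 \<notin> I\<close> by simp
  qed
qed

section \<open>Means over grids of equidistant angles\<close>

lemma sum_cis_roots_of_unity:
  fixes k :: int
  assumes N: "N > 0"
  shows "(\<Sum>i<N. cis (2 * pi * of_int k * real i / real N)) = (if int N dvd k then of_nat N else 0)"
proof -
  define w where "w = cis (2 * pi * of_int k / real N)"
  have "w ^ i = cis (2 * pi * of_int k * real i / real N)" for i
  proof -
    have "real i * (2 * pi * of_int k / real N) = 2 * pi * of_int k * real i / real N" by simp
    then show ?thesis by (simp only: w_def Complex.DeMoivre)
  qed
  then have "(\<Sum>i<N. cis (2 * pi * of_int k * real i / real N)) = (\<Sum>i<N. w ^ i)" by simp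
  also have "\<dots> = (if int N dvd k then of_nat N else 0)"
  proof (cases "int N dvd k")
    case True
    then obtain m where "k = int N * m" by blast
    then have "2 * pi * of_int k / real N = 2 * pi * of_int m" using N by simp
    then have "w = 1" unfolding w_def by (simp only: cis_multiple_2pi Ints_of_int)
    with True show ?thesis by simp
  next
    case False
    have "w \<noteq> 1"
    proof
      assume "w = 1"
      then have "cos (2 * pi * of_int k / real N) = 1" by (metis w_def cis.sel(1) one_complex.sel(1))
      then obtain n where "2 * pi * of_int k / real N = of_int n * 2 * pi" by (auto simp: cos_one_2pi_int)
      then have "of_int k = real N * of_int n" using N by (simp add: field_simps)
      then have "real_of_int k = of_int (int N * n)" by simp
      then have "k = int N * n" by (simp only: of_int_eq_iff)
      with False show False by simp
    qed
    moreover have "w ^ N = cis (2 * pi * of_int k)" using N by (simp add: w_def Complex.DeMoivre)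
    then have "w ^ N = 1" by simp
    ultimately show ?thesis using False by (simp add: geometric_sum)
  qed
  finally show ?thesis .
qed

lemma sum_cos_roots_of_unity:
  fixes k :: int
  assumes "N > 0"
  shows "(\<Sum>i<N. cos (of_int k * (2 * pi * real i / real N))) = (if int N dvd k then real N else 0)"
proof -
  have "(\<Sum>i<N. cos (of_int k * (2 * pi * real i / real N))) = Re (\<Sum>i<N. cis (2 * pi * of_int k * real i / real N))"
    by (simp add: mult_ac)
  also have "\<dots> = (if int N dvd k then real N else 0)"
    unfolding sum_cis_roots_of_unity[OF assms] by simp
  finally show ?thesis .
qed

section \<open>Grid means of functions on the square and their orthogonality relations\<close>

abbreviation square :: "(real \<times> real) set" where
  "square \<equiv> {-1..1} \<times> {-1..1}"

text \<open>A Riemann sum for the normalised integral of f(cos \<alpha>, cos \<beta>) over the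
  torus. At \<open>N = 0\<close> it is 0 by division by zero.\<close>

definition grid_mean :: "nat \<Rightarrow> (real \<times> real \<Rightarrow> real) \<Rightarrow> real" where
  "grid_mean N f =
     (\<Sum>i<N. \<Sum>j<N. f (cos (2 * pi * real i / real N), cos (2 * pi * real j / real N))) / (real N)\<^sup>2"

text \<open>In effect the integral against the product of two arcsine distributions; being a
  \<open>lim\<close>, it carries information only once convergence is known.\<close>

definition grid_lim :: "(real \<times> real \<Rightarrow> real) \<Rightarrow> real" where
  "grid_lim f = lim (\<lambda>N. grid_mean N f)"

definition cheb_prod :: "nat \<Rightarrow> nat \<Rightarrow> real \<times> real \<Rightarrow> real" where
  "cheb_prod k l = (\<lambda>x. poly (cheb k) (fst x) * poly (cheb l) (snd x))"

lemma compact_square: "compact square"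
  by (intro compact_Times compact_Icc)

lemma cheb_prod_cos: "cheb_prod k l (cos \<alpha>, cos \<beta>) = cos (real k * \<alpha>) * cos (real l * \<beta>)"
  by (simp add: cheb_prod_def poly_cheb_cos)

lemma cheb_prod_continuous: "continuous_on S (cheb_prod k l)"
  unfolding cheb_prod_def by (intro continuous_intros)

lemma square_cos:
  assumes "x \<in> square"
  obtains \<alpha> \<beta> where "\<alpha> \<in> {0..pi}" "\<beta> \<in> {0..pi}" "x = (cos \<alpha>, cos \<beta>)"
proof (rule that)
  show "arccos (fst x) \<in> {0..pi}" "arccos (snd x) \<in> {0..pi}"
    using assms by (auto intro: arccos_lbound arccos_ubound)
  show "x = (cos (arccos (fst x)), cos (arccos (snd x)))"
    using assms by (cases x) auto
qed

lemma abs_cheb_prod_le: "x \<in> square \<Longrightarrow> \<bar>cheb_prod k l x\<bar> \<le> 1"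
  by (elim square_cos) (simp add: cheb_prod_cos abs_mult mult_le_one)

lemma grid_mean_add: "grid_mean N (\<lambda>x. f x + g x) = grid_mean N f + grid_mean N g"
  by (simp add: grid_mean_def sum.distrib add_divide_distrib)

lemma grid_mean_cmult: "grid_mean N (\<lambda>x. c * f x) = c * grid_mean N f"
  by (simp add: grid_mean_def sum_distrib_left)

lemma grid_mean_mono:
  assumes "\<And>x. x \<in> square \<Longrightarrow> f x \<le> g x"
  shows "grid_mean N f \<le> grid_mean N g"
  unfolding grid_mean_def by (intro divide_right_mono sum_mono assms) auto

lemma grid_mean_const: "N > 0 \<Longrightarrow> grid_mean N (\<lambda>x. c) = c"
  by (simp add: grid_mean_def power2_eq_square)

lemma grid_mean_bound:
  assumes "\<And>x. x \<in> square \<Longrightarrow> \<bar>f x\<bar> \<le> e" and "N > 0"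
  shows "\<bar>grid_mean N f\<bar> \<le> e"
proof -
  have "f x \<le> e" "- e \<le> f x" if "x \<in> square" for x using assms(1)[OF that] by auto
  then have "grid_mean N f \<le> grid_mean N (\<lambda>x. e)" "grid_mean N (\<lambda>x. - e) \<le> grid_mean N f"
    by (auto intro!: grid_mean_mono)
  then show ?thesis using assms(2) by (auto simp: grid_mean_const)
qed

lemma grid_mean_prod:
  "grid_mean N (\<lambda>x. f (fst x) * g (snd x)) =
     (\<Sum>i<N. f (cos (2 * pi * real i / real N))) / real N * ((\<Sum>j<N. g (cos (2 * pi * real j / real N))) / real N)"
  by (simp add: grid_mean_def sum_product power2_eq_square)

text \<open>Product-to-sum formulas leave the differences and sums of the frequencies. The bounds by
  \<open>N\<close> exclude aliasing: a multiple of \<open>N\<close> occurs among them only as 0, so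
  the orthogonality relations hold exactly on the grid.\<close>

lemma grid_mean_cheb_prod_mult:
  assumes N: "N > 0" "k + k' < N" "l + l' < N"
  shows "grid_mean N (\<lambda>x. cheb_prod k l x * cheb_prod k' l' x) =
     (if k = k' then if k = 0 then 1 else 1 / 2 else 0) * (if l = l' then if l = 0 then 1 else 1 / 2 else 0)"
proof -
  have 1: "(\<Sum>i<N. poly (cheb a) (cos (2 * pi * real i / real N)) * poly (cheb b) (cos (2 * pi * real i / real N))) / real N
      = (if a = b then if a = 0 then 1 else 1 / 2 else 0)" if ab: "a + b < N" for a b
  proof -
    have "(\<Sum>i<N. poly (cheb a) (cos (2 * pi * real i / real N)) * poly (cheb b) (cos (2 * pi * real i / real N)))
       = (\<Sum>i<N. cos (of_int (int a - int b) * (2 * pi * real i / real N)) / 2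
             + cos (of_int (int a + int b) * (2 * pi * real i / real N)) / 2)"
      unfolding poly_cheb_cos cos_times_cos
      by (intro sum.cong) (simp_all add: ring_distribs add_divide_distrib diff_divide_distrib)
    also have "\<dots> = (if int N dvd int a - int b then real N else 0) / 2 + (if int N dvd int a + int b then real N else 0) / 2"
      unfolding sum.distrib sum_divide_distrib[symmetric] sum_cos_roots_of_unity[OF N(1)] ..
    also have "int N dvd int a - int b \<longleftrightarrow> a = b"
      using ab zdvd_imp_le[of "int N" "int a - int b"] zdvd_imp_le[of "int N" "int b - int a"]
      by (cases a b rule: linorder_cases) (auto simp: dvd_diff_commute)
    also have "int N dvd int a + int b \<longleftrightarrow> a = 0 \<and> b = 0"
      using ab zdvd_imp_le[of "int N" "int a + int b"] by (cases "a = 0 \<and> b = 0") auto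
    finally show ?thesis using N(1) by (auto simp: divide_simps)
  qed
  have "(\<lambda>x. cheb_prod k l x * cheb_prod k' l' x) =
      (\<lambda>x. (\<lambda>t. poly (cheb k) t * poly (cheb k') t) (fst x) * (\<lambda>s. poly (cheb l) s * poly (cheb l') s) (snd x))"
    by (simp add: cheb_prod_def mult_ac)
  then have "grid_mean N (\<lambda>x. cheb_prod k l x * cheb_prod k' l' x) = 
      grid_mean N (\<lambda>x. (\<lambda>t. poly (cheb k) t * poly (cheb k') t) (fst x) * (\<lambda>s. poly (cheb l) s * poly (cheb l') s) (snd x))"
    by (rule arg_cong)
  also have "\<dots> = (if k = k' then if k = 0 then 1 else 1 / 2 else 0) * (if l = l' then if l = 0 then 1 else 1 / 2 else 0)"
    by (rule trans[OF grid_mean_prod]) (simp only: 1[OF N(2)] 1[OF N(3)])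
  finally show ?thesis .
qed

section \<open>The span of the Chebyshev products, its density, and the limit of grid means\<close>

inductive cheb_span :: "(real \<times> real \<Rightarrow> real) \<Rightarrow> bool" where
  prod: "cheb_span (\<lambda>x. c * cheb_prod k l x)"
| add: "cheb_span f \<Longrightarrow> cheb_span g \<Longrightarrow> cheb_span (\<lambda>x. f x + g x)"

lemma cheb_span_cmult: "cheb_span f \<Longrightarrow> cheb_span (\<lambda>x. c * f x)"
proof (induction rule: cheb_span.induct)
  case (prod d k l)
  then show ?case using cheb_span.prod[of "c * d" k l] by (simp add: mult.assoc)
next
  case (add f g)
  then show ?case using cheb_span.add by (simp add: distrib_left)
qed

text \<open>The recurrence read as the action of multiplication by the variable; it makes the span
  closed under multiplication by each coordinate.\<close>

lemma cheb_times_arg: "t * poly (cheb (Suc k)) t = poly (cheb (Suc (Suc k))) t / 2 + poly (cheb k) t / 2"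
  by (simp add: field_simps)

lemma cheb_span_mult_fst: "cheb_span f \<Longrightarrow> cheb_span (\<lambda>x. fst x * f x)"
proof (induction rule: cheb_span.induct)
  case (prod c k l)
  show ?case
  proof (cases k)
    case 0
    have "(\<lambda>x. fst x * (c * cheb_prod k l x)) = (\<lambda>x. c * cheb_prod (Suc 0) l x)"
      by (simp add: cheb_prod_def 0 mult_ac)
    then show ?thesis by (simp only: cheb_span.prod)
  next
    case (Suc m)
    have "fst x * (c * cheb_prod k l x) = c / 2 * cheb_prod (Suc (Suc m)) l x + c / 2 * cheb_prod m l x" for x
      using arg_cong[OF cheb_times_arg[of "fst x" m], of "\<lambda>y. c * y * poly (cheb l) (snd x)"]
      by (simp add: cheb_prod_def Suc algebra_simps del: cheb.simps)
    then show ?thesis by (simp only: cheb_span.intros)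
  qed
next
  case (add f g)
  then show ?case using cheb_span.add by (simp add: distrib_left)
qed

lemma cheb_span_mult_snd: "cheb_span f \<Longrightarrow> cheb_span (\<lambda>x. snd x * f x)"
proof (induction rule: cheb_span.induct)
  case (prod c k l)
  show ?case
  proof (cases l)
    case 0
    have "(\<lambda>x. snd x * (c * cheb_prod k l x)) = (\<lambda>x. c * cheb_prod k (Suc 0) x)"
      by (simp add: cheb_prod_def 0 mult_ac)
    then show ?thesis by (simp only: cheb_span.prod)
  next
    case (Suc m)
    have "snd x * (c * cheb_prod k l x) = c / 2 * cheb_prod k (Suc (Suc m)) x + c / 2 * cheb_prod k m x" for x
      using arg_cong[OF cheb_times_arg[of "snd x" m], of "\<lambda>y. c * y * poly (cheb k) (fst x)"]
      by (simp add: cheb_prod_def Suc algebra_simps del: cheb.simps)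
    then show ?thesis by (simp only: cheb_span.intros)
  qed
next
  case (add f g)
  then show ?case using cheb_span.add by (simp add: distrib_left)
qed

text \<open>Multiplying an arbitrary \<open>f\<close> of the span, instead of just 1, lets the
  induction treat a product of polynomials by applying one factor after the other.\<close>

lemma cheb_span_polynomial_mult:
  assumes "real_polynomial_function (p :: real \<times> real \<Rightarrow> real)" "cheb_span f"
  shows "cheb_span (\<lambda>x. p x * f x)"
  using assms
proof (induction arbitrary: f)
  case (linear h)
  note f = linear(2)
  interpret bounded_linear h by (rule linear(1))
  have hx: "h x = fst x * h (1, 0) + snd x * h (0, 1)" for x
  proof -
    have "x = fst x *\<^sub>R (1, 0) + snd x *\<^sub>R (0, 1)" by (cases x) simp
    then have "h x = h (fst x *\<^sub>R (1, 0) + snd x *\<^sub>R (0, 1))" by simp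
    then show ?thesis unfolding add scaleR by simp
  qed
  have eq: "(\<lambda>x. h x * f x) = (\<lambda>x. h (1, 0) * (fst x * f x) + h (0, 1) * (snd x * f x))"
  proof
    fix x show "h x * f x = h (1, 0) * (fst x * f x) + h (0, 1) * (snd x * f x)"
      unfolding hx[of x] by (simp add: ring_distribs)
  qed
  show ?case
    unfolding eq
    by (rule cheb_span.add; rule cheb_span_cmult; rule cheb_span_mult_fst cheb_span_mult_snd; rule f)
next
  case (const c)
  then show ?case by (rule cheb_span_cmult)
next
  case (add p q)
  then show ?case using cheb_span.add by (simp add: distrib_right)
next
  case (mult p q)
  then show ?case by (simp add: mult.assoc)
qed

lemma cheb_span_dense:
  assumes "continuous_on square f" "e > 0"
  shows "\<exists>p. cheb_span p \<and> continuous_on square p \<and> (\<forall>x\<in>square. \<bar>f x - p x\<bar> < e)"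
proof -
  from Stone_Weierstrass_real_polynomial_function[OF compact_square assms]
  obtain p where p: "real_polynomial_function p" "\<And>x. x \<in> square \<Longrightarrow> \<bar>f x - p x\<bar> < e" by blast
  have "cheb_span (\<lambda>x. p x * (1 * cheb_prod 0 0 x))"
    by (intro cheb_span_polynomial_mult p cheb_span.prod)
  then have "cheb_span p" by (simp add: cheb_prod_def)
  moreover have "continuous_on square p"
    using p(1) continuous_on_polymonial_function real_polynomial_function_eq by blast
  ultimately show ?thesis using p(2) by (intro exI[of _ p]) simp
qed

text \<open>Orthogonality to \<open>cheb_prod 0 0\<close> makes the means of each product eventually
  constant.\<close>

lemma convergent_grid_mean_cheb_span: "cheb_span p \<Longrightarrow> convergent (\<lambda>N. grid_mean N p)"
proof (induction rule: cheb_span.induct)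
  case (prod c k l)
  have "grid_mean N (\<lambda>x. c * cheb_prod k l x) = c * ((if k = 0 then 1 else 0) * (if l = 0 then 1 else 0))"
    if "N \<ge> k + l + 1" for N
  proof -
    have "(\<lambda>x. cheb_prod k l x * cheb_prod 0 0 x) = cheb_prod k l" by (simp add: cheb_prod_def)
    then have "grid_mean N (cheb_prod k l) = (if k = 0 then 1 else 0) * (if l = 0 then 1 else 0)"
      using grid_mean_cheb_prod_mult[of N k 0 l 0] that by simp
    then show ?thesis by (simp only: grid_mean_cmult)
  qed
  then have "eventually (\<lambda>N. grid_mean N (\<lambda>x. c * cheb_prod k l x)
      = c * ((if k = 0 then 1 else 0) * (if l = 0 then 1 else 0))) sequentially"
    unfolding eventually_sequentially by (intro exI[of _ "k + l + 1"] allI impI)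
  then show ?case by (rule convergentI[OF tendsto_eventually])
next
  case (add f g)
  then show ?case by (simp add: grid_mean_add convergent_add)
qed

text \<open>Means of span elements converge, and uniform approximation moves the means by at most
  the same error for all \<open>N > 0\<close>; so the means of \<open>f\<close> form a Cauchy
  sequence.\<close>

lemma grid_mean_tendsto:
  assumes f: "continuous_on square f"
  shows "(\<lambda>N. grid_mean N f) \<longlonglongrightarrow> grid_lim f"
proof -
  have "Cauchy (\<lambda>N. grid_mean N f)"
  proof (rule CauchyI)
    fix e :: real assume e: "e > 0"
    then have "e / 4 > 0" by simp
    from cheb_span_dense[OF f this] obtain p where
      p: "cheb_span p" "continuous_on square p" "\<forall>x\<in>square. \<bar>f x - p x\<bar> < e / 4" by (elim exE conjE)
    have "Cauchy (\<lambda>N. grid_mean N p)"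
      by (rule convergent_Cauchy[OF convergent_grid_mean_cheb_span[OF p(1)]])
    from CauchyD[OF this \<open>e / 4 > 0\<close>] obtain M where
      M: "\<forall>m\<ge>M. \<forall>n\<ge>M. norm (grid_mean m p - grid_mean n p) < e / 4" ..
    have near: "\<bar>grid_mean N f - grid_mean N p\<bar> \<le> e / 4" if "N > 0" for N
    proof -
      have "\<bar>grid_mean N (\<lambda>x. f x + (- 1) * p x)\<bar> \<le> e / 4"
        using p(3) that by (intro grid_mean_bound) (auto intro: less_imp_le)
      then show ?thesis unfolding grid_mean_add grid_mean_cmult by simp
    qed
    have "\<bar>grid_mean m f - grid_mean n f\<bar> < e" if "m \<ge> Suc M" "n \<ge> Suc M" for m n
    proof -
      have "\<bar>grid_mean m p - grid_mean n p\<bar> < e / 4" using M that by auto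
      with near[of m] near[of n] that show ?thesis by linarith
    qed
    then show "\<exists>M. \<forall>m\<ge>M. \<forall>n\<ge>M. norm (grid_mean m f - grid_mean n f) < e"
      unfolding real_norm_def by blast
  qed
  then show ?thesis unfolding grid_lim_def by (simp add: Cauchy_convergent convergent_LIMSEQ_iff[symmetric])
qed

lemma grid_lim_eqI: "(\<lambda>N. grid_mean N f) \<longlonglongrightarrow> c \<Longrightarrow> grid_lim f = c"
  unfolding grid_lim_def by (rule limI)

lemma grid_lim_add:
  assumes "continuous_on square f" "continuous_on square g"
  shows "grid_lim (\<lambda>x. f x + g x) = grid_lim f + grid_lim g"
  by (rule grid_lim_eqI) (unfold grid_mean_add, intro tendsto_add grid_mean_tendsto assms)

lemma grid_lim_cmult:
  assumes "continuous_on square f"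
  shows "grid_lim (\<lambda>x. c * f x) = c * grid_lim f"
  by (rule grid_lim_eqI) (unfold grid_mean_cmult, intro tendsto_mult_left grid_mean_tendsto assms)

lemma grid_lim_sum:
  assumes "\<And>i. i \<in> F \<Longrightarrow> continuous_on square (f i)"
  shows "grid_lim (\<lambda>x. \<Sum>i\<in>F. f i x) = (\<Sum>i\<in>F. grid_lim (f i))"
  using assms
proof (induction F rule: infinite_finite_induct)
  case (insert a F)
  have "grid_lim (\<lambda>x. f a x + (\<Sum>i\<in>F. f i x)) = grid_lim (f a) + grid_lim (\<lambda>x. \<Sum>i\<in>F. f i x)"
    by (intro grid_lim_add continuous_on_sum insert.prems) simp_all
  then show ?case using insert by simp
qed (simp_all add: grid_lim_def grid_mean_def)

lemma grid_lim_bound: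
  assumes "continuous_on square f" "\<And>x. x \<in> square \<Longrightarrow> \<bar>f x\<bar> \<le> e"
  shows "\<bar>grid_lim f\<bar> \<le> e"
proof (rule LIMSEQ_le_const2)
  show "(\<lambda>N. \<bar>grid_mean N f\<bar>) \<longlonglongrightarrow> \<bar>grid_lim f\<bar>"
    by (intro tendsto_rabs grid_mean_tendsto assms)
  show "\<exists>M. \<forall>N\<ge>M. \<bar>grid_mean N f\<bar> \<le> e"
    by (intro exI[of _ 1] allI impI grid_mean_bound assms(2)) simp_all
qed

lemma grid_lim_cheb_prod_mult:
  "grid_lim (\<lambda>x. cheb_prod k l x * cheb_prod k' l' x) =
     (if k = k' then if k = 0 then 1 else 1 / 2 else 0) * (if l = l' then if l = 0 then 1 else 1 / 2 else 0)"
proof (rule grid_lim_eqI[OF tendsto_eventually])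
  show "\<forall>\<^sub>F N in sequentially. grid_mean N (\<lambda>x. cheb_prod k l x * cheb_prod k' l' x) =
     (if k = k' then if k = 0 then 1 else 1 / 2 else 0) * (if l = l' then if l = 0 then 1 else 1 / 2 else 0)"
    unfolding eventually_sequentially
    by (intro exI[of _ "Suc (k + k' + l + l')"] allI impI grid_mean_cheb_prod_mult) simp_all
qed

text \<open>If the function is positive at a point, it is bounded below on a cell of a coarse grid, and
  every refinement of that grid has a fixed proportion of its points in the cell.\<close>

lemma grid_lim_zero_imp_zero:
  assumes f: "continuous_on square f" "\<And>x. x \<in> square \<Longrightarrow> f x \<ge> 0" "grid_lim f = 0" and x: "x \<in> square"
  shows "f x = 0"
proof (rule ccontr)
  assume "f x \<noteq> 0"
  with f(2)[OF x] have pos: "f x > 0" by simp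
  obtain \<alpha> \<beta> where ab: "\<alpha> \<in> {0..pi}" "\<beta> \<in> {0..pi}" "x = (cos \<alpha>, cos \<beta>)"
    using x by (rule square_cos)
  define \<phi> where "\<phi> = (\<lambda>y. f (cos (fst y), cos (snd y)))"
  have "continuous_on UNIV \<phi>" unfolding \<phi>_def
    by (rule continuous_on_compose2[OF f(1)]) (auto intro!: continuous_intros)
  then have "isCont \<phi> (\<alpha>, \<beta>)" by (simp add: continuous_on_eq_continuous_at)
  from this[unfolded continuous_at_eps_delta, rule_format, OF half_gt_zero[OF pos]] obtain d where d: "d > 0" "\<forall>y. dist y (\<alpha>, \<beta>) < d \<longrightarrow> dist (\<phi> y) (\<phi> (\<alpha>, \<beta>)) < f x / 2"
    by (elim exE conjE)
  have near: "f (cos a, cos b) \<ge> f x / 2" if "\<bar>a - \<alpha>\<bar> < d / 2" "\<bar>b - \<beta>\<bar> < d / 2" for a b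
  proof -
    have "dist (a, b) (\<alpha>, \<beta>) \<le> \<bar>a - \<alpha>\<bar> + \<bar>b - \<beta>\<bar>"
      unfolding dist_Pair_Pair dist_real_def by (intro sqrt_sum_squares_le_sum) auto
    also have "\<dots> < d" using that by simp
    finally have "dist (\<phi> (a, b)) (\<phi> (\<alpha>, \<beta>)) < f x / 2" using d(2) by simp
    then show ?thesis
      unfolding \<phi>_def dist_real_def fst_conv snd_conv ab(3)[symmetric] by linarith
  qed
  obtain M :: nat where M: "4 * pi / d < real M" using reals_Archimedean2 by blast
  have "0 < 4 * pi / d" using d(1) by simp
  with M have M0: "M > 0" by simp
  have Md: "2 * pi / real M < d / 2" using M M0 d(1) by (simp add: field_simps)
  \<comment> \<open>\<open>cell \<theta>\<close> numbers the arc, among \<open>M\<close> equal ones,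
    that contains \<theta>. Angles up to pi keep this number below \<open>M\<close>.\<close>
  define cell where "cell \<theta> = nat \<lfloor>\<theta> * real M / (2 * pi)\<rfloor>" for \<theta> :: real
  have cell: "cell \<theta> < M" "real (cell \<theta>) \<le> \<theta> * real M / (2 * pi)" "\<theta> * real M / (2 * pi) < real (cell \<theta>) + 1"
    if "\<theta> \<in> {0..pi}" for \<theta>
  proof -
    have nn: "\<theta> * real M / (2 * pi) \<ge> 0" using that by simp
    then have c: "real (cell \<theta>) = of_int \<lfloor>\<theta> * real M / (2 * pi)\<rfloor>" unfolding cell_def by simp
    then show 2: "real (cell \<theta>) \<le> \<theta> * real M / (2 * pi)" "\<theta> * real M / (2 * pi) < real (cell \<theta>) + 1" by linarith+
    have "\<theta> * real M \<le> pi * real M" using that by (intro mult_right_mono) auto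
    also have "\<dots> < 2 * pi * real M" using M0 by simp
    finally have "\<theta> * real M / (2 * pi) < real M" by (simp add: divide_less_eq mult.commute)
    with 2 show "cell \<theta> < M" by linarith
  qed
  \<comment> \<open>Refining each arc into \<open>R\<close> parts puts these \<open>R\<close>
    indices into the arc of \<theta>, and two angles of one arc differ by less than its
    length.\<close>
  have close: "\<bar>2 * pi * real i / real (M * R) - \<theta>\<bar> < d / 2"
    if \<theta>: "\<theta> \<in> {0..pi}" and R: "R > 0" and i: "i \<in> {cell \<theta> * R..<cell \<theta> * R + R}" for \<theta> R i
  proof -
    have "real (cell \<theta>) * real R \<le> real i" "real i < (real (cell \<theta>) + 1) * real R"
      using i by (auto simp flip: of_nat_mult of_nat_add of_nat_Suc simp: algebra_simps)
    then have q: "real (cell \<theta>) \<le> real i / real R" "real i / real R < real (cell \<theta>) + 1"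
      using R by (auto simp: field_simps)
    define t where "t = real i / real R - \<theta> * real M / (2 * pi)"
    have "\<bar>t\<bar> < 1" using q cell(2,3)[OF \<theta>] unfolding t_def by linarith
    have "2 * pi * real i / real (M * R) - \<theta> = t * (2 * pi / real M)"
      using R M0 by (simp add: t_def field_simps)
    then have "\<bar>2 * pi * real i / real (M * R) - \<theta>\<bar> = \<bar>t\<bar> * (2 * pi / real M)"
      by (simp add: abs_mult)
    also have "\<dots> \<le> 1 * (2 * pi / real M)" using \<open>\<bar>t\<bar> < 1\<close> by (intro mult_right_mono) auto
    finally show ?thesis using Md by simp
  qed
  \<comment> \<open>R^2 of the (M R)^2 grid points lie in the cell: a proportion 1 / M^2,
    independent of \<open>R\<close>.\<close>
  have low: "grid_mean (M * R) f \<ge> f x / 2 / (real M)\<^sup>2" if R: "R > 0" for R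
  proof -
    define N where "N = M * R"
    define I where "I \<theta> = {cell \<theta> * R..<cell \<theta> * R + R}" for \<theta>
    have I: "I \<theta> \<subseteq> {..<N}" if "\<theta> \<in> {0..pi}" for \<theta>
    proof -
      have "(cell \<theta> + 1) * R \<le> M * R" using cell(1)[OF that] by (intro mult_right_mono) auto
      then show ?thesis by (auto simp: I_def N_def algebra_simps)
    qed
    let ?f = "\<lambda>i j. f (cos (2 * pi * real i / real N), cos (2 * pi * real j / real N))"
    have nn: "?f i j \<ge> 0" for i j by (rule f(2)) auto
    have "(\<Sum>i\<in>I \<alpha>. \<Sum>j\<in>I \<beta>. f x / 2) \<le> (\<Sum>i\<in>I \<alpha>. \<Sum>j\<in>I \<beta>. ?f i j)"
      using close[OF ab(1) R] close[OF ab(2) R] unfolding I_def N_def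
      by (intro sum_mono near) auto
    also have "\<dots> \<le> (\<Sum>i\<in>I \<alpha>. \<Sum>j<N. ?f i j)"
      using I[OF ab(2)] nn by (intro sum_mono sum_mono2) auto
    also have "\<dots> \<le> (\<Sum>i<N. \<Sum>j<N. ?f i j)"
      using I[OF ab(1)] nn by (intro sum_mono2 sum_nonneg) auto
    finally have "(real R)\<^sup>2 * (f x / 2) \<le> (\<Sum>i<N. \<Sum>j<N. ?f i j)"
      by (simp add: I_def power2_eq_square)
    then have "(real R)\<^sup>2 * (f x / 2) / (real N)\<^sup>2 \<le> grid_mean N f"
      unfolding grid_mean_def by (intro divide_right_mono) auto
    also have "(real R)\<^sup>2 * (f x / 2) / (real N)\<^sup>2 = f x / 2 / (real M)\<^sup>2"
      using R by (simp add: N_def power_mult_distrib)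
    finally show ?thesis by (simp add: N_def)
  qed
  have "strict_mono (\<lambda>R. M * Suc R)" using M0 by (simp add: strict_mono_def)
  from LIMSEQ_subseq_LIMSEQ[OF grid_mean_tendsto[OF f(1)] this]
  have "(\<lambda>R. grid_mean (M * Suc R) f) \<longlonglongrightarrow> 0" by (simp add: f(3) o_def)
  then have "f x / 2 / (real M)\<^sup>2 \<le> 0"
    by (rule LIMSEQ_le_const) (intro exI[of _ 0] allI impI low, simp)
  with pos M0 show False by (simp add: field_simps)
qed

text \<open>Completeness: \<open>u\<close> is orthogonal to a span that approximates
  \<open>u\<close> itself, so the limit mean of its square is 0, and strict positivity of the
  functional concludes.\<close>

lemma orthogonal_to_cheb_prod_imp_zero:
  assumes u: "continuous_on square u" and orth: "\<And>k l. grid_lim (\<lambda>x. u x * cheb_prod k l x) = 0" and x: "x \<in> square"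
  shows "u x = 0"
proof -
  have span: "continuous_on square p \<and> grid_lim (\<lambda>x. u x * p x) = 0" if "cheb_span p" for p
    using that
  proof (induction rule: cheb_span.induct)
    case (prod c k l)
    have "grid_lim (\<lambda>x. c * (u x * cheb_prod k l x)) = c * grid_lim (\<lambda>x. u x * cheb_prod k l x)"
      by (intro grid_lim_cmult continuous_on_mult u cheb_prod_continuous)
    moreover have "(\<lambda>x. c * (u x * cheb_prod k l x)) = (\<lambda>x. u x * (c * cheb_prod k l x))"
      by (simp add: mult_ac)
    moreover have "continuous_on square (\<lambda>x. c * cheb_prod k l x)"
      by (intro continuous_on_mult continuous_on_const cheb_prod_continuous)
    ultimately show ?case by (simp add: orth)
  next
    case (add p q)
    then have "grid_lim (\<lambda>x. u x * p x + u x * q x) = grid_lim (\<lambda>x. u x * p x) + grid_lim (\<lambda>x. u x * q x)"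
      by (intro grid_lim_add continuous_on_mult u) simp_all
    then have "grid_lim (\<lambda>x. u x * (p x + q x)) = 0" using add by (simp add: distrib_left)
    with add show ?case by (simp add: continuous_on_add)
  qed
  have "compact (u ` square)" by (rule compact_continuous_image[OF u compact_square])
  then have "bounded (u ` square)" by (rule compact_imp_bounded)
  then obtain B where uB: "\<forall>y\<in>u ` square. norm y \<le> B" unfolding bounded_iff ..
  have B: "\<bar>u x\<bar> \<le> B" if "x \<in> square" for x using bspec[OF uB imageI[OF that]] by simp
  from B[OF x] have "B \<ge> 0" by simp
  have "\<bar>grid_lim (\<lambda>x. u x * u x)\<bar> \<le> e" if "e > 0" for e
  proof -
    \<comment> \<open>\<open>B + 1\<close> instead of \<open>B\<close> allows for
      \<open>B = 0\<close>.\<close>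
    have "e / (B + 1) > 0" using that \<open>B \<ge> 0\<close> by simp
    from cheb_span_dense[OF u this] obtain p where
      p: "cheb_span p" "continuous_on square p" "\<forall>x\<in>square. \<bar>u x - p x\<bar> < e / (B + 1)" by (elim exE conjE)
    have "grid_lim (\<lambda>x. u x * p x + u x * (u x - p x)) = grid_lim (\<lambda>x. u x * p x) + grid_lim (\<lambda>x. u x * (u x - p x))"
      by (intro grid_lim_add continuous_on_mult continuous_on_diff u p(2))
    moreover have "(\<lambda>x. u x * p x + u x * (u x - p x)) = (\<lambda>x. u x * u x)"
      by (simp add: algebra_simps)
    ultimately have "grid_lim (\<lambda>x. u x * u x) = grid_lim (\<lambda>x. u x * (u x - p x))"
      using span[OF p(1)] by simp
    moreover have "\<bar>grid_lim (\<lambda>x. u x * (u x - p x))\<bar> \<le> B * (e / (B + 1))"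
    proof (rule grid_lim_bound)
      show "continuous_on square (\<lambda>x. u x * (u x - p x))" by (intro continuous_on_mult continuous_on_diff u p(2))
      fix x assume x: "x \<in> square"
      show "\<bar>u x * (u x - p x)\<bar> \<le> B * (e / (B + 1))"
        unfolding abs_mult
        by (rule mult_mono[OF B[OF x] less_imp_le[OF bspec[OF p(3) x]] \<open>B \<ge> 0\<close> abs_ge_zero])
    qed
    moreover have "B * (e / (B + 1)) \<le> e" using that \<open>B \<ge> 0\<close> by (simp add: field_simps)
    ultimately show ?thesis by simp
  qed
  then have "\<bar>grid_lim (\<lambda>x. u x * u x)\<bar> \<le> 0" by (rule field_le_epsilon) simp
  then have "u x * u x = 0"
    using grid_lim_zero_imp_zero[of "\<lambda>x. u x * u x" x] x continuous_on_mult[OF u u] by simp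
  then show ?thesis by simp
qed

section \<open>Chebyshev expansions of positive functions\<close>

text \<open>The number of signs of a frequency: the factor that turns cosine coefficients into Fourier coefficients.\<close>

definition freq_mult :: "nat \<Rightarrow> real" where
  "freq_mult k = (if k = 0 then 1 else 2)"

lemma freq_mult_pos: "freq_mult k > 0"
  by (simp add: freq_mult_def)

text \<open>For k from 1 to n the indices k and N - k carry equal values, and 2 n < N keeps the two
  ranges disjoint, so weight 2 counts both occurrences; index 0 occurs once.\<close>

lemma sum_reflect_le:
  fixes h :: "nat \<Rightarrow> real"
  assumes nn: "\<And>k. h k \<ge> 0" and sym: "\<And>k. k \<le> N \<Longrightarrow> h (N - k) = h k" and N: "2 * n < N"
  shows "(\<Sum>k\<le>n. freq_mult k * h k) \<le> (\<Sum>k<N. h k)"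
proof -
  have A: "{..n} = insert 0 {1..n}" by auto
  have "(\<Sum>k\<le>n. freq_mult k * h k) = h 0 + (\<Sum>k=1..n. 2 * h k)"
    unfolding A by (simp add: freq_mult_def)
  also have "\<dots> = (\<Sum>k\<le>n. h k) + (\<Sum>k=1..n. h k)"
    unfolding A by (simp add: sum_distrib_left[symmetric])
  also have "(\<Sum>k=1..n. h k) = (\<Sum>k=1..n. h (N - k))"
    using N by (intro sum.cong) (auto simp: sym)
  also have "\<dots> = sum h ((\<lambda>k. N - k) ` {1..n})"
    using N by (subst sum.reindex) (auto simp: inj_on_def)
  also have "(\<Sum>k\<le>n. h k) + sum h ((\<lambda>k. N - k) ` {1..n}) = sum h ({..n} \<union> (\<lambda>k. N - k) ` {1..n})"
    using N by (subst sum.union_disjoint) auto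
  also have "\<dots> \<le> (\<Sum>k<N. h k)"
    using N nn by (intro sum_mono2) auto
  finally show ?thesis .
qed

lemma grid_mean_sum: "grid_mean N (\<lambda>x. \<Sum>i\<in>F. f i x) = (\<Sum>i\<in>F. grid_mean N (f i))"
proof (induction F rule: infinite_finite_induct)
  case (insert a F)
  then show ?case using grid_mean_add[of N "f a" "\<lambda>x. \<Sum>i\<in>F. f i x"] by simp
qed (simp_all add: grid_mean_def)

lemma cheb_reflect:
  assumes "N > 0" "k \<le> N"
  shows "poly (cheb (N - k)) (cos (2 * pi * real i / real N)) = poly (cheb k) (cos (2 * pi * real i / real N))"
proof -
  have "real (N - k) * (2 * pi * real i / real N) = 2 * pi * real i - real k * (2 * pi * real i / real N)"
    using assms by (simp add: of_nat_diff field_simps)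
  moreover have "cos (2 * pi * real i - y) = cos y" for y
    using sin_2npi[of i] cos_2npi[of i] by (simp add: cos_diff mult.commute mult.left_commute)
  ultimately show ?thesis by (simp add: poly_cheb_cos)
qed

text \<open>Fourier inversion at the angle pair (0, 0): summed over all frequencies below
  \<open>N\<close>, the cosines form \<open>N\<close> times the indicator of the zero angle.\<close>

lemma grid_mean_cheb_sum:
  assumes N: "N > 0"
  shows "(\<Sum>k<N. \<Sum>l<N. grid_mean N (\<lambda>x. f x * cheb_prod k l x)) = f (1, 1)"
proof -
  define \<theta> where "\<theta> i = 2 * pi * real i / real N" for i
  have C: "(\<Sum>k<N. poly (cheb k) (cos (\<theta> i))) = (if i = 0 then real N else 0)" if "i < N" for i
  proof -
    have "(\<Sum>k<N. poly (cheb k) (cos (\<theta> i))) = (\<Sum>k<N. cos (of_int (int i) * (2 * pi * real k / real N)))"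
      by (simp add: poly_cheb_cos \<theta>_def mult_ac)
    also have "\<dots> = (if i = 0 then real N else 0)"
      unfolding sum_cos_roots_of_unity[OF N] using that by (auto dest: dvd_imp_le)
    finally show ?thesis .
  qed
  have "(\<Sum>k<N. \<Sum>l<N. grid_mean N (\<lambda>x. f x * cheb_prod k l x)) =
      grid_mean N (\<lambda>x. f x * ((\<Sum>k<N. poly (cheb k) (fst x)) * (\<Sum>l<N. poly (cheb l) (snd x))))"
    unfolding grid_mean_sum[symmetric] sum_product by (simp add: sum_distrib_left cheb_prod_def)
  also have "\<dots> = (\<Sum>i<N. \<Sum>j<N. f (cos (\<theta> i), cos (\<theta> j)) * ((if i = 0 then real N else 0) * (if j = 0 then real N else 0))) / (real N)\<^sup>2"
    unfolding grid_mean_def \<theta>_def[symmetric]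
    by (intro arg_cong[of _ _ "\<lambda>x. x / _"] sum.cong refl) (simp add: C)
  also have "\<dots> = (\<Sum>i<N. \<Sum>j<N. if i = 0 then if j = 0 then f (1, 1) * (real N)\<^sup>2 else 0 else 0) / (real N)\<^sup>2"
    by (intro arg_cong[of _ _ "\<lambda>x. x / _"] sum.cong refl) (auto simp: \<theta>_def power2_eq_square)
  also have "(\<Sum>i<N. \<Sum>j<N. if i = 0 then if j = 0 then f (1, 1) * (real N)\<^sup>2 else 0 else 0)
      = (\<Sum>i<N. if i = 0 then f (1, 1) * (real N)\<^sup>2 else 0)"
    using N by (intro sum.cong) auto
  also have "\<dots> = f (1, 1) * (real N)\<^sup>2" using N by simp
  finally show ?thesis using N by simp
qed

text \<open>The bound is independent of \<open>N\<close>, so it survives the limit and makes the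
  limit coefficients summable. Nonnegativity allows the remaining frequencies to be
  discarded.\<close>

lemma partial_coefficient_sum_le:
  assumes N: "2 * n < N" and nn: "\<And>k l. grid_mean N (\<lambda>x. f x * cheb_prod k l x) \<ge> 0"
  shows "(\<Sum>k\<le>n. \<Sum>l\<le>n. freq_mult k * freq_mult l * grid_mean N (\<lambda>x. f x * cheb_prod k l x)) \<le> f (1, 1)"
proof -
  define h where "h k l = grid_mean N (\<lambda>x. f x * cheb_prod k l x)" for k l
  have N0: "N > 0" using N by simp
  have sym1: "h (N - k) l = h k l" and sym2: "h j (N - k) = h j k" if "k \<le> N" for k l j
    unfolding h_def grid_mean_def cheb_prod_def by (simp_all add: cheb_reflect[OF N0 that])
  have "(\<Sum>k\<le>n. \<Sum>l\<le>n. freq_mult k * freq_mult l * h k l) = (\<Sum>k\<le>n. freq_mult k * (\<Sum>l\<le>n. freq_mult l * h k l))"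
    by (simp add: sum_distrib_left mult_ac)
  also have "\<dots> \<le> (\<Sum>k\<le>n. freq_mult k * (\<Sum>l<N. h k l))"
    using nn less_imp_le[OF freq_mult_pos]
    by (intro sum_mono mult_left_mono sum_reflect_le N) (auto simp: sym2 h_def[symmetric])
  also have "\<dots> \<le> (\<Sum>k<N. \<Sum>l<N. h k l)"
    using nn by (intro sum_reflect_le N sum_nonneg) (auto simp: sym1 h_def[symmetric])
  also have "\<dots> = f (1, 1)" unfolding h_def by (rule grid_mean_cheb_sum[OF N0])
  finally show ?thesis unfolding h_def .
qed

theorem cheb_series_of_positive:
  fixes f :: "real \<times> real \<Rightarrow> real"
  assumes f: "continuous_on square f"
    and nn: "\<And>N k l. N > 0 \<Longrightarrow> grid_mean N (\<lambda>x. f x * cheb_prod k l x) \<ge> 0"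
  shows "\<exists>a. (\<forall>k l. a k l \<ge> 0) \<and> (\<lambda>(k, l). a k l) summable_on UNIV \<and>
    (\<forall>x\<in>square. ((\<lambda>(k, l). a k l * cheb_prod k l x) has_sum f x) UNIV)"
proof -
  define b where "b k l = grid_lim (\<lambda>x. f x * cheb_prod k l x)" for k l
  \<comment> \<open>\<open>freq_mult\<close> compensates for the squared norm 1 / 2 of a nonconstant
    cosine.\<close>
  define a where "a k l = freq_mult k * freq_mult l * b k l" for k l
  have ct: "continuous_on square (\<lambda>x. f x * cheb_prod k l x)" for k l
    by (intro continuous_on_mult f cheb_prod_continuous)
  have lim: "(\<lambda>N. grid_mean N (\<lambda>x. f x * cheb_prod k l x)) \<longlonglongrightarrow> b k l" for k l
    unfolding b_def by (rule grid_mean_tendsto[OF ct])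
  have "b k l \<ge> 0" for k l
    by (rule LIMSEQ_le_const[OF lim]) (auto intro!: exI[of _ 1] nn)
  then have a0: "a k l \<ge> 0" for k l unfolding a_def using freq_mult_pos[of k] freq_mult_pos[of l] by simp
  have bound: "(\<Sum>k\<le>n. \<Sum>l\<le>n. a k l) \<le> f (1, 1)" for n
  proof (rule LIMSEQ_le_const2)
    show "(\<lambda>N. \<Sum>k\<le>n. \<Sum>l\<le>n. freq_mult k * freq_mult l * grid_mean N (\<lambda>x. f x * cheb_prod k l x))
        \<longlonglongrightarrow> (\<Sum>k\<le>n. \<Sum>l\<le>n. a k l)"
      unfolding a_def by (intro tendsto_sum tendsto_mult_left lim)
    show "\<exists>M. \<forall>N\<ge>M. (\<Sum>k\<le>n. \<Sum>l\<le>n. freq_mult k * freq_mult l * grid_mean N (\<lambda>x. f x * cheb_prod k l x)) \<le> f (1, 1)"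
      by (intro exI[of _ "Suc (2 * n)"] allI impI partial_coefficient_sum_le nn) auto
  qed
  have summ: "(\<lambda>(k, l). a k l) summable_on UNIV"
  proof (rule nonneg_bdd_above_summable_on)
    show "bdd_above (sum (\<lambda>(k, l). a k l) ` {F. F \<subseteq> UNIV \<and> finite F})"
    proof (rule bdd_aboveI2)
      fix F :: "(nat \<times> nat) set" assume "F \<in> {F. F \<subseteq> UNIV \<and> finite F}"
      then have F: "finite F" by simp
      then obtain n where n: "\<forall>m\<in>fst ` F \<union> snd ` F. m \<le> n"
        using finite_nat_set_iff_bounded_le[of "fst ` F \<union> snd ` F"] by auto
      have "F \<subseteq> {..n} \<times> {..n}"
      proof
        fix p assume "p \<in> F"
        then have "fst p \<le> n" "snd p \<le> n" using n by auto
        then show "p \<in> {..n} \<times> {..n}" by (cases p) simp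
      qed
      then have "sum (\<lambda>(k, l). a k l) F \<le> sum (\<lambda>(k, l). a k l) ({..n} \<times> {..n})"
        using a0 by (intro sum_mono2) auto
      also have "\<dots> = (\<Sum>k\<le>n. \<Sum>l\<le>n. a k l)" by (simp add: sum.cartesian_product)
      finally show "sum (\<lambda>(k, l). a k l) F \<le> f (1, 1)" using bound[of n] by simp
    qed
  qed (use a0 in auto)
  define g where "g = (\<lambda>(k, l) x. a k l * cheb_prod k l x)"
  define h where "h x = infsum (\<lambda>p. g p x) UNIV" for x
  have gle: "norm (g p x) \<le> (\<lambda>(k, l). a k l) p" if "x \<in> square" for p x
  proof (cases p)
    case (Pair k l)
    have "a k l * \<bar>cheb_prod k l x\<bar> \<le> a k l * 1"
      using abs_cheb_prod_le[OF that] a0 by (intro mult_left_mono) auto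
    then show ?thesis using a0[of k l] by (simp add: Pair g_def abs_mult)
  qed
  \<comment> \<open>Chebyshev products are bounded by 1 on the square, so the coefficients
    themselves majorise the series; the uniform limit gives continuity of \<open>h\<close>.\<close>
  have unif: "uniform_limit square (\<lambda>F x. \<Sum>p\<in>F. g p x) h (finite_subsets_at_top UNIV)"
    unfolding h_def by (rule Weierstrass_m_test_general[OF gle summ])
  have hs: "((\<lambda>p. g p x) has_sum h x) UNIV" if "x \<in> square" for x
    using tendsto_uniform_limitI[OF unif that] by (simp add: has_sum_def)
  have gc: "continuous_on square (g p)" for p
    unfolding g_def by (cases p) (auto intro!: continuous_intros cheb_prod_continuous)
  have hc: "continuous_on square h"
    by (rule uniform_limit_theorem[OF _ unif]) (auto intro!: always_eventually continuous_on_sum gc)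
  \<comment> \<open>Every finite partial sum whose index set contains (k, l) already has coefficient
    exactly \<open>b k l\<close>; uniform closeness transfers this to \<open>h\<close>.\<close>
  have hlim: "grid_lim (\<lambda>x. h x * cheb_prod k l x) = b k l" for k l
  proof -
    have "\<bar>grid_lim (\<lambda>x. h x * cheb_prod k l x) - b k l\<bar> \<le> 0 + e" if "e > 0" for e
    proof -
      from uniform_limitD[OF unif that] obtain F0 where F0: "finite F0"
        "\<forall>F. finite F \<and> F0 \<subseteq> F \<longrightarrow> (\<forall>x\<in>square. dist (\<Sum>p\<in>F. g p x) (h x) < e)"
        unfolding eventually_finite_subsets_at_top by auto
      define F where "F = insert (k, l) F0"
      have F: "finite F" "(k, l) \<in> F" and near: "\<forall>x\<in>square. dist (\<Sum>p\<in>F. g p x) (h x) < e"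
        using F0 unfolding F_def by auto
      define s where "s x = (\<Sum>p\<in>F. g p x)" for x
      have sc: "continuous_on square s" unfolding s_def by (intro continuous_on_sum gc)
      have coord: "grid_lim (\<lambda>x. g p x * cheb_prod k l x) = (if p = (k, l) then b k l else 0)" for p
      proof (cases p)
        case (Pair k' l')
        have "grid_lim (\<lambda>x. a k' l' * (cheb_prod k' l' x * cheb_prod k l x))
            = a k' l' * grid_lim (\<lambda>x. cheb_prod k' l' x * cheb_prod k l x)"
          by (intro grid_lim_cmult continuous_on_mult cheb_prod_continuous)
        then show ?thesis
          by (auto simp: Pair g_def mult.assoc grid_lim_cheb_prod_mult a_def freq_mult_def)
      qed
      have "grid_lim (\<lambda>x. s x * cheb_prod k l x) = grid_lim (\<lambda>x. \<Sum>p\<in>F. g p x * cheb_prod k l x)"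
        by (simp add: s_def sum_distrib_right)
      also have "\<dots> = (\<Sum>p\<in>F. grid_lim (\<lambda>x. g p x * cheb_prod k l x))"
        by (intro grid_lim_sum continuous_on_mult gc cheb_prod_continuous)
      also have "\<dots> = b k l" unfolding coord using F by simp
      finally have s: "grid_lim (\<lambda>x. s x * cheb_prod k l x) = b k l" .
      have "grid_lim (\<lambda>x. s x * cheb_prod k l x + (h x - s x) * cheb_prod k l x)
          = b k l + grid_lim (\<lambda>x. (h x - s x) * cheb_prod k l x)"
        unfolding s[symmetric] by (intro grid_lim_add continuous_on_mult continuous_on_diff sc hc cheb_prod_continuous)
      then have "grid_lim (\<lambda>x. h x * cheb_prod k l x) - b k l = grid_lim (\<lambda>x. (h x - s x) * cheb_prod k l x)"
        by (simp add: algebra_simps)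
      moreover have "\<bar>grid_lim (\<lambda>x. (h x - s x) * cheb_prod k l x)\<bar> \<le> e"
      proof (rule grid_lim_bound)
        show "continuous_on square (\<lambda>x. (h x - s x) * cheb_prod k l x)"
          by (intro continuous_on_mult continuous_on_diff sc hc cheb_prod_continuous)
        fix x assume x: "x \<in> square"
        have "\<bar>h x - s x\<bar> \<le> e"
          using bspec[OF near x] by (simp add: s_def dist_real_def abs_minus_commute)
        then show "\<bar>(h x - s x) * cheb_prod k l x\<bar> \<le> e"
          unfolding abs_mult using mult_mono[OF _ abs_cheb_prod_le[OF x], of "\<bar>h x - s x\<bar>" e] that by simp
      qed
      ultimately show ?thesis by simp
    qed
    then have "\<bar>grid_lim (\<lambda>x. h x * cheb_prod k l x) - b k l\<bar> \<le> 0" by (rule field_le_epsilon)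
    then show ?thesis by simp
  qed
  have "f x - h x = 0" if "x \<in> square" for x
  proof (rule orthogonal_to_cheb_prod_imp_zero[OF _ _ that])
    show "continuous_on square (\<lambda>x. f x - h x)" by (intro continuous_on_diff f hc)
    fix k l
    have "grid_lim (\<lambda>x. f x * cheb_prod k l x + (- 1) * (h x * cheb_prod k l x)) = b k l + (- 1) * b k l"
      unfolding hlim[of k l, symmetric]
      by (subst grid_lim_add, intro ct, intro continuous_intros hc cheb_prod_continuous,
          subst grid_lim_cmult, intro continuous_intros hc cheb_prod_continuous, simp add: b_def hlim)
    then show "grid_lim (\<lambda>x. (f x - h x) * cheb_prod k l x) = 0" by (simp add: algebra_simps)
  qed
  then have "((\<lambda>(k, l). a k l * cheb_prod k l x) has_sum f x) UNIV" if "x \<in> square" for x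
    using hs[OF that] that by (simp add: g_def case_prod_unfold)
  with a0 summ show ?thesis by blast
qed

section \<open>Quadratic forms on the torus\<close>

lemma finite_set_enumeration:
  assumes "finite M" "M \<noteq> {}"
  obtains b where "bij_betw b {..<card M} M" "card M \<ge> 1"
proof -
  from ex_bij_betw_nat_finite[OF assms(1)] obtain b where "bij_betw b {0..<card M} M" ..
  moreover have "card M \<ge> 1" using assms by (simp add: Suc_le_eq card_gt_0_iff)
  ultimately show ?thesis using that by (simp add: atLeast0LessThan)
qed

text \<open>The definition numbers the points by an initial segment of the naturals; enumerating
  \<open>M\<close> carries it over to any finite index set, in particular to pairs of grid
  indices.\<close>

lemma positive_definite_on_finite_set:
  assumes K: "positive_definite_on X K" and M: "finite M" "inj_on x M" "x ` M \<subseteq> X"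
  shows "(\<Sum>\<mu>\<in>M. \<Sum>\<nu>\<in>M. c \<mu> * c \<nu> * K (x \<mu>) (x \<nu>)) \<ge> 0"
proof (cases "M = {}")
  case False
  obtain b where b: "bij_betw b {..<card M} M" "card M \<ge> 1"
    using M(1) False by (rule finite_set_enumeration)
  have im: "b ` {..<card M} = M" using b(1) by (rule bij_betw_imp_surj_on)
  have "inj_on (x \<circ> b) {..<card M}"
    using b(1) M(2) by (intro comp_inj_on) (simp_all add: bij_betw_def)
  moreover have "(x \<circ> b) ` {..<card M} \<subseteq> X" using M(3) im by (metis image_comp)
  ultimately have "(\<Sum>\<mu><card M. \<Sum>\<nu><card M. (c \<circ> b) \<mu> * (c \<circ> b) \<nu> * K ((x \<circ> b) \<mu>) ((x \<circ> b) \<nu>)) \<ge> 0"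
    using K[unfolded positive_definite_on_def, rule_format, OF b(2), of "x \<circ> b" "c \<circ> b"] by simp
  then show ?thesis
    by (simp add: sum.reindex_bij_betw[OF b(1), symmetric])
qed simp

lemma strictly_positive_definite_on_finite_set:
  assumes K: "strictly_positive_definite_on X K" and M: "finite M" "inj_on x M" "x ` M \<subseteq> X"
    and c: "\<mu>0 \<in> M" "c \<mu>0 \<noteq> 0"
  shows "(\<Sum>\<mu>\<in>M. \<Sum>\<nu>\<in>M. c \<mu> * c \<nu> * K (x \<mu>) (x \<nu>)) > 0"
proof -
  have "M \<noteq> {}" using c by blast
  obtain b where b: "bij_betw b {..<card M} M" "card M \<ge> 1"
    using M(1) \<open>M \<noteq> {}\<close> by (rule finite_set_enumeration)
  have im: "b ` {..<card M} = M" using b(1) by (rule bij_betw_imp_surj_on)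
  have "inj_on (x \<circ> b) {..<card M}"
    using b(1) M(2) by (intro comp_inj_on) (simp_all add: bij_betw_def)
  moreover have "(x \<circ> b) ` {..<card M} \<subseteq> X" using M(3) im by (metis image_comp)
  moreover have "\<exists>\<mu><card M. (c \<circ> b) \<mu> \<noteq> 0"
  proof -
    from c(1) im obtain m where "m < card M" "\<mu>0 = b m" by auto
    with c(2) show ?thesis by auto
  qed
  ultimately have "(\<Sum>\<mu><card M. \<Sum>\<nu><card M. (c \<circ> b) \<mu> * (c \<circ> b) \<nu> * K ((x \<circ> b) \<mu>) ((x \<circ> b) \<nu>)) > 0"
    using conjunct2[OF K[unfolded strictly_positive_definite_on_def], rule_format, OF b(2), of "x \<circ> b" "c \<circ> b"] by simp
  then show ?thesis
    by (simp add: sum.reindex_bij_betw[OF b(1), symmetric])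
qed

section \<open>Angles as coordinates on the circle and the torus\<close>

definition circle_point :: "real \<Rightarrow> real ^ 2" where
  "circle_point t = cos t *\<^sub>R axis 1 1 + sin t *\<^sub>R axis 2 1"

lemma inner_circle_point: "circle_point s \<bullet> circle_point t = cos (s - t)"
proof -
  have "axis 1 1 \<bullet> (axis 1 1 :: real ^ 2) = 1" "axis 2 1 \<bullet> (axis 2 1 :: real ^ 2) = 1"
    "axis 1 1 \<bullet> (axis 2 1 :: real ^ 2) = 0" "axis 2 1 \<bullet> (axis 1 1 :: real ^ 2) = 0"
    by (simp_all add: inner_axis_axis)
  then show ?thesis by (simp add: circle_point_def inner_add_left inner_add_right cos_diff)
qed

lemma circle_point_in_circle: "circle_point t \<in> circle"
  using inner_circle_point[of t t] by (simp add: norm_eq_sqrt_inner)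

lemma circle_point_cases:
  assumes "v \<in> circle"
  shows "\<exists>t. v = circle_point t"
proof -
  have "v \<bullet> v = 1" using assms by (simp add: norm_eq_sqrt_inner)
  then have "(v $ 1)\<^sup>2 + (v $ 2)\<^sup>2 = 1" by (simp add: inner_vec_def sum_2 power2_eq_square)
  then obtain t where "v $ 1 = cos t" "v $ 2 = sin t" by (rule sincos_total_2pi)
  then have "v = circle_point t"
    by (simp add: circle_point_def vec_eq_iff forall_2 axis_def)
  then show ?thesis ..
qed

lemma circle_point_eqD:
  assumes "circle_point s = circle_point t"
  shows "cos (s - t) = 1"
  using inner_circle_point[of s t] inner_circle_point[of t t] assms by simp

lemma circle_point_eq_iff_cis: "circle_point s = circle_point t \<longleftrightarrow> cis s = cis t"
proof -
  have "circle_point s $ 1 = cos s" "circle_point s $ 2 = sin s" for s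
    by (simp_all add: circle_point_def axis_def)
  then have "circle_point s = circle_point t \<longleftrightarrow> cos s = cos t \<and> sin s = sin t"
    by (simp add: vec_eq_iff forall_2)
  also have "\<dots> \<longleftrightarrow> cis s = cis t" by (simp add: complex_eq_iff)
  finally show ?thesis .
qed

definition torus_point :: "real \<Rightarrow> real \<Rightarrow> (real ^ 2) \<times> (real ^ 2)" where
  "torus_point s t = (circle_point s, circle_point t)"

lemma torus_point_in_torus: "torus_point s t \<in> circle \<times> circle"
  unfolding torus_point_def using circle_point_in_circle by blast

lemma isotropic_kernel_torus_point:
  "isotropic_part K Kr \<Longrightarrow> K (torus_point s t) (torus_point s' t') = Kr (cos (s - s')) (cos (t - t'))"
  using circle_point_in_circle by (simp add: isotropic_part_def torus_point_def inner_circle_point del: mem_sphere_0)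

text \<open>Fixing the first point at angles (0, 0) and moving the second by arccos exhibits
  \<open>Kr\<close> on the square as a composition with the continuous kernel.\<close>

lemma isotropic_part_continuous:
  assumes "continuous_kernel K" "isotropic_part K Kr"
  shows "continuous_on square (\<lambda>x. Kr (fst x) (snd x))"
proof -
  define q where "q x = (torus_point 0 0, torus_point (arccos (fst x)) (arccos (snd x)))" for x :: "real \<times> real"
  have "continuous_on square q"
    unfolding q_def torus_point_def circle_point_def by (intro continuous_intros) auto
  moreover have "q ` square \<subseteq> (circle \<times> circle) \<times> (circle \<times> circle)"
    unfolding q_def using torus_point_in_torus by blast
  ultimately have ct: "continuous_on square (\<lambda>x. (\<lambda>(p, q). K p q) (q x))"
    by (rule continuous_on_compose2[OF assms(1)[unfolded continuous_kernel_def]])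
  have eq: "(\<lambda>(p, q). K p q) (q x) = Kr (fst x) (snd x)" if "x \<in> square" for x
  proof -
    have "cos (arccos (fst x)) = fst x" "cos (arccos (snd x)) = snd x"
      using that by (auto intro: cos_arccos)
    then show ?thesis by (simp add: q_def isotropic_kernel_torus_point[OF assms(2)])
  qed
  show ?thesis by (rule continuous_on_eq[OF ct eq])
qed

text \<open>The weights exp(i u) enter through their real and imaginary parts: the addition theorem
  splits the form into one with weights cos u and one with weights sin u.\<close>

lemma positive_definite_cos_form:
  assumes K: "positive_definite_on X K" and M: "finite M" "inj_on x M" "x ` M \<subseteq> X"
  shows "(\<Sum>\<mu>\<in>M. \<Sum>\<nu>\<in>M. cos (u \<mu> - u \<nu>) * K (x \<mu>) (x \<nu>)) \<ge> 0"
proof -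
  have "(\<Sum>\<mu>\<in>M. \<Sum>\<nu>\<in>M. cos (u \<mu> - u \<nu>) * K (x \<mu>) (x \<nu>)) =
      (\<Sum>\<mu>\<in>M. \<Sum>\<nu>\<in>M. cos (u \<mu>) * cos (u \<nu>) * K (x \<mu>) (x \<nu>)) +
      (\<Sum>\<mu>\<in>M. \<Sum>\<nu>\<in>M. sin (u \<mu>) * sin (u \<nu>) * K (x \<mu>) (x \<nu>))"
    by (simp add: cos_diff distrib_right sum.distrib)
  also have "\<dots> \<ge> 0" by (intro add_nonneg_nonneg positive_definite_on_finite_set[OF K M])
  finally show ?thesis .
qed

text \<open>By periodicity the grid angles form a cyclic group, so a translation only permutes the
  summands; the induction shifts by one step at a time.\<close>

lemma sum_grid_shift:
  fixes G :: "real \<Rightarrow> real"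
  assumes per: "\<And>y. G (y + 2 * pi) = G y" and N: "N > 0"
  shows "(\<Sum>i<N. G (2 * pi * real i / real N - 2 * pi * real m / real N)) = (\<Sum>i<N. G (2 * pi * real i / real N))"
proof (induction m)
  case (Suc m)
  define h where "h i = G (2 * pi * real i / real N - 2 * pi * real (Suc m) / real N)" for i
  have "2 * pi * real N / real N - 2 * pi * real (Suc m) / real N = (2 * pi * real 0 / real N - 2 * pi * real (Suc m) / real N) + 2 * pi"
    using N by simp
  then have "h N = h 0" unfolding h_def by (simp only: per)
  have "2 * pi * real (Suc i) / real N - 2 * pi * real (Suc m) / real N = 2 * pi * real i / real N - 2 * pi * real m / real N" for i
    by (simp add: diff_divide_distrib[symmetric] ring_distribs)
  then have "(\<Sum>i<N. h (Suc i)) = (\<Sum>i<N. G (2 * pi * real i / real N))"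
    unfolding h_def using Suc.IH by simp
  moreover have "h 0 + (\<Sum>i<N. h (Suc i)) = (\<Sum>i<N. h i) + h N"
    using sum.lessThan_Suc_shift[of h N] sum.lessThan_Suc[of h N] by simp
  ultimately show ?case using \<open>h N = h 0\<close> unfolding h_def by simp
qed simp

section \<open>Grids on the torus and the signs of the grid coefficients\<close>

definition grid :: "nat \<Rightarrow> (nat \<times> nat) set" where
  "grid N = {..<N} \<times> {..<N}"

definition grid_point :: "nat \<Rightarrow> nat \<times> nat \<Rightarrow> (real ^ 2) \<times> (real ^ 2)" where
  "grid_point N p = torus_point (2 * pi * real (fst p) / real N) (2 * pi * real (snd p) / real N)"

lemma inj_on_grid_point:
  assumes N: "N > 0"
  shows "inj_on (grid_point N) (grid N)"
proof -
  have eq: "i = j" if ij: "i < N" "j < N" and "circle_point (2 * pi * real i / real N) = circle_point (2 * pi * real j / real N)" for i j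
  proof -
    from circle_point_eqD[OF that(3)] obtain n where "2 * pi * real i / real N - 2 * pi * real j / real N = of_int n * 2 * pi"
      by (auto simp: cos_one_2pi_int)
    then have "2 * pi * ((real i - real j) / real N) = 2 * pi * of_int n"
      by (simp add: right_diff_distrib diff_divide_distrib mult_ac)
    then have "real i - real j = of_int n * real N" using N by (simp add: divide_eq_eq)
    then have "real_of_int (int i - int j) = of_int (n * int N)" by simp
    then have "int i - int j = n * int N" by (simp only: of_int_eq_iff)
    then have "int N dvd int i - int j" by simp
    then show ?thesis
      using ij zdvd_imp_le[of "int N" "int i - int j"] zdvd_imp_le[of "int N" "int j - int i"]
      by (cases i j rule: linorder_cases) (auto simp: dvd_diff_commute)
  qed
  show ?thesis
  proof (rule inj_onI)
    fix p q assume "p \<in> grid N" "q \<in> grid N" "grid_point N p = grid_point N q"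
    then show "p = q"
      using eq[of "fst p" "fst q"] eq[of "snd p" "snd q"]
      by (cases p, cases q) (simp add: grid_def grid_point_def torus_point_def)
  qed
qed

lemma grid_point_in_torus: "grid_point N ` A \<subseteq> circle \<times> circle"
  unfolding grid_point_def using torus_point_in_torus by blast

text \<open>The kernel depends on angle differences only, so averaging over all base points of the
  grid turns the coefficient into a quadratic form. A product of two cosines is a half-sum of two,
  whence the two forms with phases \<open>U\<close> and \<open>V\<close>.\<close>

lemma grid_mean_cheb_prod_nonneg:
  assumes K: "positive_definite_on (circle \<times> circle) K" "isotropic_part K Kr" and N: "N > 0"
  shows "grid_mean N (\<lambda>x. Kr (fst x) (snd x) * cheb_prod k l x) \<ge> 0"
proof -
  define \<theta> where "\<theta> i = 2 * pi * real i / real N" for i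
  define \<Phi> where "\<Phi> a b = Kr (cos a) (cos b) * (cos (real k * a) * cos (real l * b))" for a b
  have cper: "cos (real m * (y + 2 * pi)) = cos (real m * y)" for m y
  proof -
    have "real m * (y + 2 * pi) = real m * y + 2 * real m * pi" by (simp add: algebra_simps)
    then show ?thesis by (simp add: cos_add)
  qed
  have per: "\<Phi> (a + 2 * pi) b = \<Phi> a b" "\<Phi> a (b + 2 * pi) = \<Phi> a b" for a b
    by (simp_all add: \<Phi>_def cper)
  have shift: "(\<Sum>i<N. \<Sum>j<N. \<Phi> (\<theta> i - \<theta> i') (\<theta> j - \<theta> j')) = (\<Sum>i<N. \<Sum>j<N. \<Phi> (\<theta> i) (\<theta> j))" for i' j'
  proof -
    have "(\<Sum>j<N. \<Phi> a (\<theta> j - \<theta> j')) = (\<Sum>j<N. \<Phi> a (\<theta> j))" for a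
      unfolding \<theta>_def by (rule sum_grid_shift[where G = "\<Phi> a", OF per(2) N])
    moreover have "(\<Sum>i<N. \<Sum>j<N. \<Phi> (\<theta> i - \<theta> i') (\<theta> j)) = (\<Sum>i<N. \<Sum>j<N. \<Phi> (\<theta> i) (\<theta> j))"
      unfolding \<theta>_def by (rule sum_grid_shift[where G = "\<lambda>a. \<Sum>j<N. \<Phi> a (2 * pi * real j / real N)", OF _ N]) (simp add: per)
    ultimately show ?thesis by simp
  qed
  define U where "U p = real k * \<theta> (fst p) + real l * \<theta> (snd p)" for p
  define V where "V p = real k * \<theta> (fst p) - real l * \<theta> (snd p)" for p
  have fin: "finite (grid N)" by (simp add: grid_def)
  have term_eq: "\<Phi> (\<theta> (fst p) - \<theta> (fst q)) (\<theta> (snd p) - \<theta> (snd q)) =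
      cos (U p - U q) * K (grid_point N p) (grid_point N q) / 2 + cos (V p - V q) * K (grid_point N p) (grid_point N q) / 2" for p q
  proof -
    have "K (grid_point N p) (grid_point N q) = Kr (cos (\<theta> (fst p) - \<theta> (fst q))) (cos (\<theta> (snd p) - \<theta> (snd q)))"
      unfolding grid_point_def \<theta>_def by (rule isotropic_kernel_torus_point[OF K(2)])
    moreover have "U p - U q = real k * (\<theta> (fst p) - \<theta> (fst q)) + real l * (\<theta> (snd p) - \<theta> (snd q))"
      "V p - V q = real k * (\<theta> (fst p) - \<theta> (fst q)) - real l * (\<theta> (snd p) - \<theta> (snd q))"
      by (simp_all add: U_def V_def algebra_simps)
    ultimately show ?thesis unfolding \<Phi>_def cos_times_cos
      by (simp add: distrib_left add_divide_distrib mult.commute)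
  qed
  note nn = positive_definite_cos_form[OF K(1) fin inj_on_grid_point[OF N] grid_point_in_torus]
  have "0 \<le> (\<Sum>p\<in>grid N. \<Sum>q\<in>grid N. cos (U p - U q) * K (grid_point N p) (grid_point N q)) / 2
      + (\<Sum>p\<in>grid N. \<Sum>q\<in>grid N. cos (V p - V q) * K (grid_point N p) (grid_point N q)) / 2"
    using nn[of U] nn[of V] by simp
  also have "\<dots> = (\<Sum>p\<in>grid N. \<Sum>q\<in>grid N. \<Phi> (\<theta> (fst p) - \<theta> (fst q)) (\<theta> (snd p) - \<theta> (snd q)))"
    unfolding term_eq by (simp add: sum.distrib sum_divide_distrib)
  also have "\<dots> = (\<Sum>q\<in>grid N. \<Sum>p\<in>grid N. \<Phi> (\<theta> (fst p) - \<theta> (fst q)) (\<theta> (snd p) - \<theta> (snd q)))"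
    by (rule sum.swap)
  \<comment> \<open>Translation by the grid point \<open>q\<close> leaves the inner sum unchanged,
    so \<open>N ^ 2\<close> equal sums remain.\<close>
  also have "\<dots> = (\<Sum>q\<in>grid N. \<Sum>i<N. \<Sum>j<N. \<Phi> (\<theta> i) (\<theta> j))"
  proof (rule sum.cong[OF refl])
    fix q
    have "(\<Sum>p\<in>grid N. \<Phi> (\<theta> (fst p) - \<theta> (fst q)) (\<theta> (snd p) - \<theta> (snd q))) =
        (\<Sum>i<N. \<Sum>j<N. \<Phi> (\<theta> i - \<theta> (fst q)) (\<theta> j - \<theta> (snd q)))"
      unfolding grid_def sum.cartesian_product by (simp add: case_prod_unfold)
    then show "(\<Sum>p\<in>grid N. \<Phi> (\<theta> (fst p) - \<theta> (fst q)) (\<theta> (snd p) - \<theta> (snd q))) = (\<Sum>i<N. \<Sum>j<N. \<Phi> (\<theta> i) (\<theta> j))"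
      unfolding shift .
  qed
  also have "\<dots> = real N ^ 2 * (\<Sum>i<N. \<Sum>j<N. \<Phi> (\<theta> i) (\<theta> j))"
    by (simp add: grid_def power2_eq_square)
  finally have "0 \<le> (\<Sum>i<N. \<Sum>j<N. \<Phi> (\<theta> i) (\<theta> j))"
    using N by (simp add: zero_le_mult_iff)
  then show ?thesis
    unfolding grid_mean_def \<Phi>_def \<theta>_def by (intro divide_nonneg_nonneg) (simp_all add: cheb_prod_cos)
qed

lemma cheb_1: "poly (cheb k) 1 = 1"
  using poly_cheb_cos[of k 0] by simp

text \<open>\<open>cheb_coeff\<close> is a choice, so its properties follow once one expansion has
  been constructed from the isotropic part.\<close>

theorem cheb_expansion_exists:
  assumes "continuous_kernel K" "isotropic K" "positive_definite_on (circle \<times> circle) K"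
  shows "cheb_expansion K (cheb_coeff K)"
proof -
  from assms(2) obtain Kr where Kr: "isotropic_part K Kr" by (auto simp: isotropic_def)
  have "\<exists>a. (\<forall>k l. a k l \<ge> 0) \<and> (\<lambda>(k, l). a k l) summable_on UNIV \<and>
    (\<forall>x\<in>square. ((\<lambda>(k, l). a k l * cheb_prod k l x) has_sum Kr (fst x) (snd x)) UNIV)"
    by (rule cheb_series_of_positive[OF isotropic_part_continuous[OF assms(1) Kr]])
      (rule grid_mean_cheb_prod_nonneg[OF assms(3) Kr])
  then obtain a where a: "\<forall>k l. a k l \<ge> 0" "(\<lambda>(k, l). a k l) summable_on UNIV"
    "\<forall>x\<in>square. ((\<lambda>(k, l). a k l * cheb_prod k l x) has_sum Kr (fst x) (snd x)) UNIV"
    by (elim exE conjE)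
  have "((\<lambda>(k, l). a k l * poly (cheb k) t * poly (cheb l) s) has_sum Kr t s) UNIV" if "t \<in> {-1..1}" "s \<in> {-1..1}" for t s
  proof -
    have "(t, s) \<in> square" using that by blast
    from bspec[OF a(3) this] show ?thesis by (simp add: cheb_prod_def mult.assoc)
  qed
  then have "cheb_expansion K a"
    unfolding cheb_expansion_def cheb_1 using a(1,2) Kr by auto
  then show ?thesis unfolding cheb_coeff_def by (rule someI[of "cheb_expansion K" a])
qed

section \<open>Strict positive definiteness in terms of exponential sums\<close>

text \<open>The Fourier transform, at integer frequencies, of the real measure with mass
  \<open>c \<mu>\<close> at the angles (\<alpha> \<mu>, \<beta> \<mu>).\<close>

definition char_sum :: "'i set \<Rightarrow> ('i \<Rightarrow> real) \<Rightarrow> ('i \<Rightarrow> real) \<Rightarrow> ('i \<Rightarrow> real) \<Rightarrow> int \<Rightarrow> int \<Rightarrow> complex" where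
  "char_sum M c \<alpha> \<beta> k l = (\<Sum>\<mu>\<in>M. complex_of_real (c \<mu>) * cis (of_int k * \<alpha> \<mu> + of_int l * \<beta> \<mu>))"

lemma char_sum_powi:
  "char_sum M c \<alpha> \<beta> k l = (\<Sum>\<mu>\<in>M. complex_of_real (c \<mu>) * cis (\<alpha> \<mu>) powi k * cis (\<beta> \<mu>) powi l)"
  by (simp add: char_sum_def cis_power_int cis_mult[symmetric] mult.assoc)

text \<open>The weights are real, so negating the frequency conjugates the sum.\<close>

lemma norm_char_sum_uminus: "cmod (char_sum M c \<alpha> \<beta> (- k) (- l)) = cmod (char_sum M c \<alpha> \<beta> k l)"
proof -
  have "of_int (- k) * \<alpha> \<mu> + of_int (- l) * \<beta> \<mu> = - (of_int k * \<alpha> \<mu> + of_int l * \<beta> \<mu>)" for \<mu>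
    by simp
  then have "char_sum M c \<alpha> \<beta> (- k) (- l) = cnj (char_sum M c \<alpha> \<beta> k l)"
    unfolding char_sum_def by (simp only: cnj_sum complex_cnj_mult complex_cnj_complex_of_real cis_cnj[symmetric])
  then show ?thesis by simp
qed

lemma cos_form_eq_norm:
  "(\<Sum>\<mu>\<in>M. \<Sum>\<nu>\<in>M. c \<mu> * c \<nu> * cos (u \<mu> - u \<nu>)) = (cmod (\<Sum>\<mu>\<in>M. complex_of_real (c \<mu>) * cis (u \<mu>)))\<^sup>2"
proof -
  have "(cmod (\<Sum>\<mu>\<in>M. complex_of_real (c \<mu>) * cis (u \<mu>)))\<^sup>2 = (\<Sum>\<mu>\<in>M. c \<mu> * cos (u \<mu>))\<^sup>2 + (\<Sum>\<mu>\<in>M. c \<mu> * sin (u \<mu>))\<^sup>2"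
    by (simp add: cmod_power2)
  also have "\<dots> = (\<Sum>\<mu>\<in>M. \<Sum>\<nu>\<in>M. c \<mu> * c \<nu> * cos (u \<mu> - u \<nu>))"
    by (simp add: power2_eq_square sum_product sum.distrib[symmetric] cos_diff distrib_left mult_ac)
  finally show ?thesis by simp
qed

lemma has_sum_sum_index:
  fixes f :: "'i \<Rightarrow> 'a \<Rightarrow> real"
  assumes "\<And>i. i \<in> M \<Longrightarrow> (f i has_sum s i) A"
  shows "((\<lambda>x. \<Sum>i\<in>M. f i x) has_sum (\<Sum>i\<in>M. s i)) A"
  using assms
proof (induction M rule: infinite_finite_induct)
  case (insert i M)
  then show ?case by (simp add: has_sum_add)
qed simp_all

text \<open>Each product cos (k x) cos (l y) is the half-sum of the cosines with frequencies (k, l)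
  and (k, -l), and each of these contributes a squared modulus. This makes every term nonnegative as
  soon as \<open>a\<close> is.\<close>

lemma kernel_form_has_sum:
  assumes E: "\<forall>t\<in>{-1..1}. \<forall>s\<in>{-1..1}. ((\<lambda>(k, l). a k l * poly (cheb k) t * poly (cheb l) s) has_sum Kr t s) UNIV"
  shows "((\<lambda>(k, l). a k l * (((cmod (char_sum M c \<alpha> \<beta> (int k) (int l)))\<^sup>2 + (cmod (char_sum M c \<alpha> \<beta> (int k) (- int l)))\<^sup>2) / 2))
    has_sum (\<Sum>\<mu>\<in>M. \<Sum>\<nu>\<in>M. c \<mu> * c \<nu> * Kr (cos (\<alpha> \<mu> - \<alpha> \<nu>)) (cos (\<beta> \<mu> - \<beta> \<nu>)))) UNIV"
proof -
  define g where "g \<mu> \<nu> p = c \<mu> * c \<nu> * (case p of (k, l) \<Rightarrow> a k l * poly (cheb k) (cos (\<alpha> \<mu> - \<alpha> \<nu>)) * poly (cheb l) (cos (\<beta> \<mu> - \<beta> \<nu>)))" for \<mu> \<nu> p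
  have "(g \<mu> \<nu> has_sum (c \<mu> * c \<nu> * Kr (cos (\<alpha> \<mu> - \<alpha> \<nu>)) (cos (\<beta> \<mu> - \<beta> \<nu>)))) UNIV" for \<mu> \<nu>
    unfolding g_def by (intro has_sum_cmult_right bspec[OF bspec[OF E]]) auto
  then have hs: "((\<lambda>p. \<Sum>\<mu>\<in>M. \<Sum>\<nu>\<in>M. g \<mu> \<nu> p) has_sum (\<Sum>\<mu>\<in>M. \<Sum>\<nu>\<in>M. c \<mu> * c \<nu> * Kr (cos (\<alpha> \<mu> - \<alpha> \<nu>)) (cos (\<beta> \<mu> - \<beta> \<nu>)))) UNIV"
    by (intro has_sum_sum_index)
  have eq: "(\<Sum>\<mu>\<in>M. \<Sum>\<nu>\<in>M. g \<mu> \<nu> (k, l)) =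
      a k l * (((cmod (char_sum M c \<alpha> \<beta> (int k) (int l)))\<^sup>2 + (cmod (char_sum M c \<alpha> \<beta> (int k) (- int l)))\<^sup>2) / 2)" for k l
  proof -
    define U where "U \<mu> = real k * \<alpha> \<mu> + real l * \<beta> \<mu>" for \<mu>
    define V where "V \<mu> = real k * \<alpha> \<mu> - real l * \<beta> \<mu>" for \<mu>
    have "g \<mu> \<nu> (k, l) = a k l / 2 * (c \<mu> * c \<nu> * cos (V \<mu> - V \<nu>) + c \<mu> * c \<nu> * cos (U \<mu> - U \<nu>))" for \<mu> \<nu>
    proof -
      have U: "U \<mu> - U \<nu> = real k * (\<alpha> \<mu> - \<alpha> \<nu>) + real l * (\<beta> \<mu> - \<beta> \<nu>)"
        and V: "V \<mu> - V \<nu> = real k * (\<alpha> \<mu> - \<alpha> \<nu>) - real l * (\<beta> \<mu> - \<beta> \<nu>)"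
        by (simp_all add: U_def V_def algebra_simps)
      have "g \<mu> \<nu> (k, l) = c \<mu> * c \<nu> * (a k l * (cos (real k * (\<alpha> \<mu> - \<alpha> \<nu>)) * cos (real l * (\<beta> \<mu> - \<beta> \<nu>))))"
        by (simp add: g_def poly_cheb_cos)
      then show ?thesis unfolding cos_times_cos U V by (simp add: field_simps)
    qed
    then have "(\<Sum>\<mu>\<in>M. \<Sum>\<nu>\<in>M. g \<mu> \<nu> (k, l)) = a k l / 2 *
        ((\<Sum>\<mu>\<in>M. \<Sum>\<nu>\<in>M. c \<mu> * c \<nu> * cos (V \<mu> - V \<nu>)) + (\<Sum>\<mu>\<in>M. \<Sum>\<nu>\<in>M. c \<mu> * c \<nu> * cos (U \<mu> - U \<nu>)))"
      by (simp only: sum_distrib_left[symmetric] sum.distrib)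
    also have "(\<Sum>\<mu>\<in>M. \<Sum>\<nu>\<in>M. c \<mu> * c \<nu> * cos (V \<mu> - V \<nu>)) = (cmod (char_sum M c \<alpha> \<beta> (int k) (- int l)))\<^sup>2"
      unfolding cos_form_eq_norm by (simp add: char_sum_def V_def)
    also have "(\<Sum>\<mu>\<in>M. \<Sum>\<nu>\<in>M. c \<mu> * c \<nu> * cos (U \<mu> - U \<nu>)) = (cmod (char_sum M c \<alpha> \<beta> (int k) (int l)))\<^sup>2"
      unfolding cos_form_eq_norm by (simp add: char_sum_def U_def)
    finally show ?thesis by simp
  qed
  have "(\<lambda>p. \<Sum>\<mu>\<in>M. \<Sum>\<nu>\<in>M. g \<mu> \<nu> p) =
      (\<lambda>(k, l). a k l * (((cmod (char_sum M c \<alpha> \<beta> (int k) (int l)))\<^sup>2 + (cmod (char_sum M c \<alpha> \<beta> (int k) (- int l)))\<^sup>2) / 2))"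
  proof
    fix p show "(\<Sum>\<mu>\<in>M. \<Sum>\<nu>\<in>M. g \<mu> \<nu> p) = (case p of (k, l) \<Rightarrow>
      a k l * (((cmod (char_sum M c \<alpha> \<beta> (int k) (int l)))\<^sup>2 + (cmod (char_sum M c \<alpha> \<beta> (int k) (- int l)))\<^sup>2) / 2))"
      by (cases p) (simp only: eq prod.case)
  qed
  with hs show ?thesis by (simp only:)
qed

definition signed_support :: "(nat \<Rightarrow> nat \<Rightarrow> real) \<Rightarrow> (int \<times> int) set" where
  "signed_support a = {(k, l). a (nat \<bar>k\<bar>) (nat \<bar>l\<bar>) > 0}"

text \<open>A convergent sum of nonnegative terms vanishes only termwise. The terms test the signs
  (+, +) and (+, -) of a frequency; conjugation adds the other two.\<close>

lemma kernel_form_eq_0_iff: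
  assumes a: "\<forall>k l. a k l \<ge> 0"
    and E: "\<forall>t\<in>{-1..1}. \<forall>s\<in>{-1..1}. ((\<lambda>(k, l). a k l * poly (cheb k) t * poly (cheb l) s) has_sum Kr t s) UNIV"
  shows "(\<Sum>\<mu>\<in>M. \<Sum>\<nu>\<in>M. c \<mu> * c \<nu> * Kr (cos (\<alpha> \<mu> - \<alpha> \<nu>)) (cos (\<beta> \<mu> - \<beta> \<nu>))) = 0 \<longleftrightarrow>
    (\<forall>(k, l)\<in>signed_support a. char_sum M c \<alpha> \<beta> k l = 0)"
    (is "?Q = 0 \<longleftrightarrow> _")
proof -
  define S where "S = char_sum M c \<alpha> \<beta>"
  define t where "t = (\<lambda>(k, l). a k l * (((cmod (S (int k) (int l)))\<^sup>2 + (cmod (S (int k) (- int l)))\<^sup>2) / 2))"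
  have t: "(t has_sum ?Q) UNIV" unfolding t_def S_def by (rule kernel_form_has_sum[OF E])
  have nn: "t p \<ge> 0" for p using a by (cases p) (simp add: t_def)
  have S0: "S k l = 0 \<longleftrightarrow> S (- k) (- l) = 0" for k l
    using norm_char_sum_uminus[of M c \<alpha> \<beta> k l] unfolding S_def by (metis norm_eq_zero)
  have t0: "t (k, l) = 0 \<longleftrightarrow> a k l = 0 \<or> (S (int k) (int l) = 0 \<and> S (int k) (- int l) = 0)" for k l
    by (simp add: t_def add_nonneg_eq_0_iff)
  have "?Q = 0 \<longleftrightarrow> (\<forall>p. t p = 0)"
  proof
    assume Q: "?Q = 0"
    then show "\<forall>p. t p = 0" using nonneg_has_sum_le_0D[OF t _ nn] by simp
  next
    assume *: "\<forall>p. t p = 0"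
    have "(t has_sum 0) UNIV" by (rule has_sum_0) (rule spec[OF *])
    then show "?Q = 0" using t has_sum_unique by blast
  qed
  also have "\<dots> \<longleftrightarrow> (\<forall>(k, l)\<in>signed_support a. S k l = 0)"
  proof
    assume *: "\<forall>p. t p = 0"
    show "\<forall>(k, l)\<in>signed_support a. S k l = 0"
    proof (intro ballI, clarify)
      fix k l assume "(k, l) \<in> signed_support a"
      then have "a (nat \<bar>k\<bar>) (nat \<bar>l\<bar>) \<noteq> 0" by (simp add: signed_support_def)
      then have S: "S \<bar>k\<bar> \<bar>l\<bar> = 0" "S \<bar>k\<bar> (- \<bar>l\<bar>) = 0"
        using *[rule_format, of "(nat \<bar>k\<bar>, nat \<bar>l\<bar>)"] unfolding t0 by simp_all
      then have "S (- \<bar>k\<bar>) (- \<bar>l\<bar>) = 0" "S (- \<bar>k\<bar>) \<bar>l\<bar> = 0"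
        using S0[of "\<bar>k\<bar>" "\<bar>l\<bar>"] S0[of "\<bar>k\<bar>" "- \<bar>l\<bar>"] by simp_all
      with S show "S k l = 0" by (cases "k \<ge> 0"; cases "l \<ge> 0") simp_all
    qed
  next
    assume *: "\<forall>(k, l)\<in>signed_support a. S k l = 0"
    have "t (k, l) = 0" for k l
    proof (cases "a k l = 0")
      case False
      with a have "a k l > 0" by (simp add: less_le)
      then have "(int k, int l) \<in> signed_support a" "(int k, - int l) \<in> signed_support a"
        by (simp_all add: signed_support_def)
      from bspec[OF * this(1)] bspec[OF * this(2)] show ?thesis by (simp add: t0)
    qed (simp add: t0)
    then show "\<forall>p. t p = 0" by simp
  qed
  finally show ?thesis unfolding S_def .
qed

text \<open>Linear independence by interpolation: \<open>sep z\<close> vanishes at all other first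
  coordinates and \<open>sep w\<close> at all other second ones, so their product isolates the point
  \<open>\<mu>0\<close>.\<close>

lemma power_sums_eq_0_imp_coefficients_eq_0:
  fixes c z w :: "'i \<Rightarrow> 'a::field"
  assumes M: "finite M" "inj_on (\<lambda>\<mu>. (z \<mu>, w \<mu>)) M" and \<mu>0: "\<mu>0 \<in> M"
    and zero: "\<And>k l. (\<Sum>\<mu>\<in>M. c \<mu> * z \<mu> ^ k * w \<mu> ^ l) = 0"
  shows "c \<mu>0 = 0"
proof -
  define sep where "sep f = (\<Prod>x\<in>f ` M - {f \<mu>0}. [:- x, 1:])" for f :: "'i \<Rightarrow> 'a"
  have fin: "finite (f ` M - {f \<mu>0})" for f :: "'i \<Rightarrow> 'a" using M(1) by simp
  have sep0: "poly (sep f) (f \<mu>0) \<noteq> 0" for f :: "'i \<Rightarrow> 'a"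
    unfolding sep_def poly_prod by (simp add: prod_zero_iff[OF fin])
  have sep1: "poly (sep f) (f \<mu>) = 0" if "\<mu> \<in> M" "f \<mu> \<noteq> f \<mu>0" for f :: "'i \<Rightarrow> 'a" and \<mu>
    unfolding sep_def poly_prod using that by (simp add: prod_zero_iff[OF fin])
  define p where "p = sep z"
  define q where "q = sep w"
  have "(\<Sum>\<mu>\<in>M. c \<mu> * (poly p (z \<mu>) * poly q (w \<mu>))) =
      (\<Sum>\<mu>\<in>M. \<Sum>i\<le>degree p. \<Sum>j\<le>degree q. coeff p i * coeff q j * (c \<mu> * z \<mu> ^ i * w \<mu> ^ j))"
  proof (intro sum.cong refl)
    fix \<mu>
    have "poly p (z \<mu>) * poly q (w \<mu>) = (\<Sum>i\<le>degree p. \<Sum>j\<le>degree q. coeff p i * z \<mu> ^ i * (coeff q j * w \<mu> ^ j))"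
      unfolding poly_altdef by (rule sum_product)
    then show "c \<mu> * (poly p (z \<mu>) * poly q (w \<mu>)) =
        (\<Sum>i\<le>degree p. \<Sum>j\<le>degree q. coeff p i * coeff q j * (c \<mu> * z \<mu> ^ i * w \<mu> ^ j))"
      by (simp add: sum_distrib_left mult_ac)
  qed
  also have "\<dots> = (\<Sum>i\<le>degree p. \<Sum>\<mu>\<in>M. \<Sum>j\<le>degree q. coeff p i * coeff q j * (c \<mu> * z \<mu> ^ i * w \<mu> ^ j))"
    by (rule sum.swap)
  also have "\<dots> = (\<Sum>i\<le>degree p. \<Sum>j\<le>degree q. \<Sum>\<mu>\<in>M. coeff p i * coeff q j * (c \<mu> * z \<mu> ^ i * w \<mu> ^ j))"
    by (intro sum.cong refl sum.swap)
  also have "\<dots> = 0" unfolding sum_distrib_left[symmetric] zero by simp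
  finally have "(\<Sum>\<mu>\<in>M. c \<mu> * (poly p (z \<mu>) * poly q (w \<mu>))) = 0" .
  \<comment> \<open>Another point may share one coordinate with \<open>\<mu>0\<close> but not both,
    so at least one of the two factors vanishes.\<close>
  moreover have off: "c \<mu> * (poly p (z \<mu>) * poly q (w \<mu>)) = 0" if "\<mu> \<in> M - {\<mu>0}" for \<mu>
  proof -
    have "(z \<mu>, w \<mu>) \<noteq> (z \<mu>0, w \<mu>0)" using that inj_onD[OF M(2), of \<mu> \<mu>0] \<mu>0 by blast
    then have "z \<mu> \<noteq> z \<mu>0 \<or> w \<mu> \<noteq> w \<mu>0" by simp
    then show ?thesis using that sep1[of \<mu> z] sep1[of \<mu> w] unfolding p_def q_def by auto
  qed
  have "(\<Sum>\<mu>\<in>M - {\<mu>0}. c \<mu> * (poly p (z \<mu>) * poly q (w \<mu>))) = 0"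
    by (intro sum.neutral ballI) (rule off)
  then have "(\<Sum>\<mu>\<in>M. c \<mu> * (poly p (z \<mu>) * poly q (w \<mu>))) = c \<mu>0 * (poly p (z \<mu>0) * poly q (w \<mu>0))"
    by (subst sum.remove[OF M(1) \<mu>0]) simp
  ultimately show ?thesis using sep0[of z] sep0[of w] unfolding p_def q_def by simp
qed

text \<open>The exponential sum of the coefficients $\cos(2\pi(i v_1 + j v_2)/N)$ over the grid is supported on
  the two cosets of $\pm v$ modulo $N$.\<close>

lemma grid_char_sum_eq_0:
  fixes v1 v2 k l :: int
  assumes N: "N > 0" and "\<not> (int N dvd k + v1 \<and> int N dvd l + v2)" "\<not> (int N dvd k - v1 \<and> int N dvd l - v2)"
  shows "char_sum (grid N) (\<lambda>p. cos (of_int v1 * (2 * pi * real (fst p) / real N) + of_int v2 * (2 * pi * real (snd p) / real N)))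
    (\<lambda>p. 2 * pi * real (fst p) / real N) (\<lambda>p. 2 * pi * real (snd p) / real N) k l = 0"
proof -
  have sum0: "(\<Sum>p\<in>grid N. cis (of_int m * (2 * pi * real (fst p) / real N) + of_int n * (2 * pi * real (snd p) / real N))) = 0"
    if "\<not> (int N dvd m \<and> int N dvd n)" for m n :: int
  proof -
    have "(\<Sum>p\<in>grid N. cis (of_int m * (2 * pi * real (fst p) / real N) + of_int n * (2 * pi * real (snd p) / real N))) =
        (\<Sum>i<N. cis (2 * pi * of_int m * real i / real N)) * (\<Sum>j<N. cis (2 * pi * of_int n * real j / real N))"
      unfolding sum_product grid_def sum.cartesian_product
      by (simp add: case_prod_unfold cis_mult mult_ac)
    then show ?thesis unfolding sum_cis_roots_of_unity[OF N] using that by auto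
  qed
  \<comment> \<open>The sum splits into complete character sums at (k + v1, l + v2) and (k - v1, l -
    v2), each zero unless both entries are multiples of \<open>N\<close>.\<close>
  have split: "complex_of_real (cos x) * cis y = cis (y + x) / 2 + cis (y - x) / 2" for x y
    by (simp add: complex_eq_iff cos_add cos_diff sin_add sin_diff field_simps)
  have "of_int k * x + of_int l * y + (of_int v1 * x + of_int v2 * y) = of_int (k + v1) * x + of_int (l + v2) * y"
    "of_int k * x + of_int l * y - (of_int v1 * x + of_int v2 * y) = of_int (k - v1) * x + of_int (l - v2) * y"
    for x y :: real by (simp_all add: algebra_simps)
  then show ?thesis
    unfolding char_sum_def split sum.distrib sum_divide_distrib[symmetric]
    by (simp only: sum0[OF assms(2)] sum0[OF assms(3)]) simp
qed

text \<open>The implications run in a cycle from (i) to (ii) to (iii) and back to (i); the middle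
  one is the inclusion of the rectangular lattices, with \<open>b = 0\<close>, among all
  lattices.\<close>

theorem theorem3p5:
  fixes K :: torus_kernel
  assumes "continuous_kernel K"
    and "isotropic K"
    and "positive_definite_on (circle \<times> circle) K"
  shows "(strictly_positive_definite_on (circle \<times> circle) K \<longleftrightarrow>
            (\<forall>L. lattice L \<longrightarrow> intersects_all_translations (symmetrized_J K) L)) \<and>
         ((\<forall>L. lattice L \<longrightarrow> intersects_all_translations (symmetrized_J K) L) \<longleftrightarrow>
            (\<forall>L. rectangular_lattice L \<longrightarrow> intersects_all_translations (symmetrized_J K) L))"
proof -
  define a where "a = cheb_coeff K"
  have "cheb_expansion K a" unfolding a_def by (rule cheb_expansion_exists[OF assms])
  then obtain Kr where a: "\<forall>k l. a k l \<ge> 0" and Kr: "isotropic_part K Kr"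
    and E: "\<forall>t\<in>{-1..1}. \<forall>s\<in>{-1..1}. ((\<lambda>(k, l). a k l * poly (cheb k) t * poly (cheb l) s) has_sum Kr t s) UNIV"
    unfolding cheb_expansion_def by (elim exE conjE)
  have sJ: "symmetrized_J K = signed_support a"
    unfolding symmetrized_J_def J_def signed_support_def a_def by simp
  have i_ii: "intersects_all_translations (symmetrized_J K) L"
    if strict: "strictly_positive_definite_on (circle \<times> circle) K" and "lattice L" for L
    unfolding intersects_all_translations_def
  proof (intro allI notI)
    fix v :: "int \<times> int"
    assume disj: "symmetrized_J K \<inter> (\<lambda>u. v + u) ` L = {}"
    obtain v1 v2 where v: "v = (v1, v2)" by (cases v)
    from \<open>lattice L\<close> obtain e b d where L: "e > 0" "d > 0" "L = {(p * e, p * b + q * d) | p q. True}"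
      unfolding lattice_def by blast
    \<comment> \<open>\<open>N\<close> is the index of \<open>L\<close>, so N Z^2 lies in
      \<open>L\<close> and an avoided translate of \<open>L\<close> contains an avoided translate of
      N Z^2.\<close>
    define N where "N = nat (e * d)"
    have N: "N > 0" "int N = e * d" using L by (simp_all add: N_def)
    have NL: "(int N * p, int N * q) \<in> L" for p q
    proof -
      \<comment> \<open>Taking \<open>d * p\<close> copies of (e, b) reaches the first entry and
        adds d p b to the second, which copies of (0, d) remove.\<close>
      have "(int N * p, int N * q) = ((d * p) * e, (d * p) * b + (e * q - p * b) * d)"
        unfolding N(2) by (simp add: algebra_simps)
      then show ?thesis unfolding L(3) by blast
    qed
    have avoid: "\<not> (int N dvd k - v1 \<and> int N dvd l - v2)" if "(k, l) \<in> signed_support a" for k l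
    proof
      assume "int N dvd k - v1 \<and> int N dvd l - v2"
      then obtain p q where "k - v1 = int N * p" "l - v2 = int N * q" unfolding dvd_def by blast
      then have "(k, l) = v + (int N * p, int N * q)" by (simp add: v)
      then have "(k, l) \<in> (\<lambda>u. v + u) ` L" using NL by blast
      with that disj sJ show False by blast
    qed
    \<comment> \<open>The support is symmetric under negation, so the coset of - v is avoided as
      well; the real weights below involve both v and - v.\<close>
    have avoid': "\<not> (int N dvd k + v1 \<and> int N dvd l + v2)" if "(k, l) \<in> signed_support a" for k l
    proof -
      have "(- k, - l) \<in> signed_support a" using that by (simp add: signed_support_def)
      from avoid[OF this] show ?thesis
        using dvd_minus_iff[of "int N" "k + v1"] dvd_minus_iff[of "int N" "l + v2"] by (simp add: add.commute)
    qed
    define c where "c p = cos (of_int v1 * (2 * pi * real (fst p) / real N) + of_int v2 * (2 * pi * real (snd p) / real N))" for p :: "nat \<times> nat"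
    define \<alpha> where "\<alpha> p = 2 * pi * real (fst p) / real N" for p :: "nat \<times> nat"
    define \<beta> where "\<beta> p = 2 * pi * real (snd p) / real N" for p :: "nat \<times> nat"
    have "char_sum (grid N) c \<alpha> \<beta> k l = 0" if "(k, l) \<in> signed_support a" for k l
      unfolding c_def \<alpha>_def \<beta>_def by (rule grid_char_sum_eq_0[OF N(1) avoid'[OF that] avoid[OF that]])
    then have "\<forall>(k, l)\<in>signed_support a. char_sum (grid N) c \<alpha> \<beta> k l = 0" by blast
    then have "(\<Sum>p\<in>grid N. \<Sum>q\<in>grid N. c p * c q * Kr (cos (\<alpha> p - \<alpha> q)) (cos (\<beta> p - \<beta> q))) = 0"
      unfolding kernel_form_eq_0_iff[OF a E] .
    moreover have "K (grid_point N p) (grid_point N q) = Kr (cos (\<alpha> p - \<alpha> q)) (cos (\<beta> p - \<beta> q))" for p q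
      unfolding grid_point_def \<alpha>_def \<beta>_def by (rule isotropic_kernel_torus_point[OF Kr])
    moreover have "(\<Sum>p\<in>grid N. \<Sum>q\<in>grid N. c p * c q * K (grid_point N p) (grid_point N q)) > 0"
    proof (rule strictly_positive_definite_on_finite_set[OF strict _ inj_on_grid_point[OF N(1)] grid_point_in_torus])
      show "finite (grid N)" "(0, 0) \<in> grid N" using N(1) by (simp_all add: grid_def)
      show "c (0, 0) \<noteq> 0" by (simp add: c_def)
    qed
    ultimately show False by simp
  qed
  have ii_iii: "intersects_all_translations (symmetrized_J K) L"
    if ii: "\<forall>L. lattice L \<longrightarrow> intersects_all_translations (symmetrized_J K) L" and "rectangular_lattice L" for L
  proof -
    from that(2) obtain e d where "e > 0" "d > 0" "L = {(p * e, q * d) | p q. True}"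
      unfolding rectangular_lattice_def by blast
    then have "lattice L" unfolding lattice_def by (intro exI[of _ e] exI[of _ 0] exI[of _ d]) simp
    with ii show ?thesis by blast
  qed
  have iii_i: "strictly_positive_definite_on (circle \<times> circle) K"
    if iii: "\<forall>L. rectangular_lattice L \<longrightarrow> intersects_all_translations (symmetrized_J K) L"
    unfolding strictly_positive_definite_on_def
  proof (intro conjI allI impI)
    show "positive_definite_on (circle \<times> circle) K" by (rule assms(3))
    fix n :: nat and x c
    assume n: "1 \<le> n" and x: "inj_on x {..<n} \<and> x ` {..<n} \<subseteq> circle \<times> circle \<and> (\<exists>\<mu><n. c \<mu> \<noteq> (0::real))"
    then obtain \<mu>0 where \<mu>0: "\<mu>0 < n" "c \<mu>0 \<noteq> 0" by blast
    let ?Q = "\<Sum>\<mu><n. \<Sum>\<nu><n. c \<mu> * c \<nu> * K (x \<mu>) (x \<nu>)"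
    have "\<exists>s t. x \<mu> = torus_point s t" if "\<mu> < n" for \<mu>
    proof -
      have "x \<mu> \<in> circle \<times> circle" using x that by blast
      then show ?thesis
        using circle_point_cases[of "fst (x \<mu>)"] circle_point_cases[of "snd (x \<mu>)"]
        unfolding torus_point_def by (cases "x \<mu>") auto
    qed
    then obtain \<alpha> \<beta> where x_eq: "\<And>\<mu>. \<mu> < n \<Longrightarrow> x \<mu> = torus_point (\<alpha> \<mu>) (\<beta> \<mu>)" by metis
    have "?Q = (\<Sum>\<mu><n. \<Sum>\<nu><n. c \<mu> * c \<nu> * Kr (cos (\<alpha> \<mu> - \<alpha> \<nu>)) (cos (\<beta> \<mu> - \<beta> \<nu>)))"
      by (intro sum.cong refl) (simp add: x_eq isotropic_kernel_torus_point[OF Kr])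
    then have Q0: "?Q = 0 \<longleftrightarrow> (\<forall>(k, l)\<in>signed_support a. char_sum {..<n} c \<alpha> \<beta> k l = 0)"
      using kernel_form_eq_0_iff[OF a E, where M = "{..<n}" and c = c and \<alpha> = \<alpha> and \<beta> = \<beta>] by simp
    have "?Q \<ge> 0" using x by (intro positive_definite_on_finite_set[OF assms(3)]) simp_all
    moreover have "?Q \<noteq> 0"
    proof
      assume "?Q = 0"
      then have S0: "\<forall>(k, l)\<in>signed_support a. char_sum {..<n} c \<alpha> \<beta> k l = 0" unfolding Q0 .
      \<comment> \<open>Angles are determined only modulo 2 pi; the unit complex numbers are what
        distinguishes the points.\<close>
      have inj: "inj_on (\<lambda>\<mu>. (cis (\<alpha> \<mu>), cis (\<beta> \<mu>))) {..<n}"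
      proof (rule inj_onI)
        fix \<mu> \<nu> assume \<mu>\<nu>: "\<mu> \<in> {..<n}" "\<nu> \<in> {..<n}" "(cis (\<alpha> \<mu>), cis (\<beta> \<mu>)) = (cis (\<alpha> \<nu>), cis (\<beta> \<nu>))"
        then have "x \<mu> = x \<nu>" by (simp add: x_eq torus_point_def circle_point_eq_iff_cis)
        with x \<mu>\<nu> show "\<mu> = \<nu>" by (meson inj_onD)
      qed
      have "\<exists>k0 l0. char_sum {..<n} c \<alpha> \<beta> k0 l0 \<noteq> 0"
      proof (rule ccontr)
        assume "\<nexists>k0 l0. char_sum {..<n} c \<alpha> \<beta> k0 l0 \<noteq> 0"
        then have "char_sum {..<n} c \<alpha> \<beta> (int k) (int l) = 0" for k l by simp
        then have "(\<Sum>\<mu><n. complex_of_real (c \<mu>) * cis (\<alpha> \<mu>) ^ k * cis (\<beta> \<mu>) ^ l) = 0" for k l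
          unfolding char_sum_powi power_int_of_nat .
        from power_sums_eq_0_imp_coefficients_eq_0[OF _ inj _ this, of \<mu>0] \<mu>0 show False by simp
      qed
      then obtain k0 l0 where "char_sum {..<n} c \<alpha> \<beta> k0 l0 \<noteq> 0" by blast
      from exponential_sum_nonzero_on_coset[OF _ _ char_sum_powi this]
      obtain q where q: "q > 0" "\<forall>i j. char_sum {..<n} c \<alpha> \<beta> (k0 + q * i) (l0 + q * j) \<noteq> 0" by auto
      define L where "L = {(i * q, j * q) | i j. True}"
      have "rectangular_lattice L" unfolding rectangular_lattice_def L_def using q(1) by blast
      \<comment> \<open>The support meets the coset on which the sum has no zero, against the
        vanishing of the sum on the support.\<close>
      with iii have "intersects_all_translations (symmetrized_J K) L" by blast
      then have "symmetrized_J K \<inter> (\<lambda>u. (k0, l0) + u) ` L \<noteq> {}"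
        unfolding intersects_all_translations_def by blast
      then obtain i j where "(k0 + q * i, l0 + q * j) \<in> signed_support a"
        unfolding sJ L_def by (auto simp: mult.commute)
      with S0 q(2) show False by blast
    qed
    ultimately show "?Q > 0" by simp
  qed
  show ?thesis using i_ii ii_iii iii_i by blast
qed

end
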